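(* Suppose $\mathfrak{C}_{AR(1)}\subseteq\mathfrak{C}$. Fix $(R,r)$ with $\operatorname{rank}(R)=q$, fix $0<C<\infty$, and fix $a_1\in\{1,2\}$, $a_2\in\{n-1,n\}$ with $a_1\le a_2$; suppose $k\le a_2-a_1$. 1. For $e\in\{e_+,e_-\}$ define $\mathfrak{X}_{1,FGLS}(e)=\{X\in\mathfrak{X}_0:e\in N_{2,X}^*(a_1,a_2)\}$ and $\mathfrak{X}_{2,FGLS}(e)=\{X\in\mathfrak{X}_0\setminus\mathfrak{X}_{1,FGLS}(e):T_{FGLS,X}(e+\mu_0^* )=C\}$, where $\mu_0^*\in\mathfrak{M}_{0,X}$ is arbitrary (the latter set does not depend on the choice of $\mu_0^*$). Then $\mathfrak{X}_{1,FGLS}(e_+)$ and $\mathfrak{X}_{1,FGLS}(e_-)$ are $\lambda_{\mathbb{R}^{n\times k}}$-null sets. The same is true for $\mathfrak{X}_{2,FGLS}(e_+)$ (respectively $\mathfrak{X}_{2,FGLS}(e_-)$) under the provision that it is a proper subset of $\mathfrak{X}_0\setminus\mathfrak{X}_{1,FGLS}(e_+)$ (respectively $\mathfrak{X}_0\setminus\mathfrak{X}_{1,FGLS}(e_-)$). The set of all $X\in\mathfrak{X}_0$ which are not FGLS-covered is a subset of $$(\mathfrak{X}_{1,FGLS}(e_+)\cup\mathfrak{X}_{2,FGLS}(e_+))\cap(\mathfrak{X}_{1,FGLS}(e_-)\cup\mathfrak{X}_{2,FGLS}(e_-)).$$ Hence it is a $\lambda_{\mathbb{R}^{n\times k}}$-null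 set provided the preceding provision holds for at least one of $\mathfrak{X}_{2,FGLS}(e_+)$ or $\mathfrak{X}_{2,FGLS}(e_-)$; moreover $\mathfrak{X}_0$ differs from $\mathbb{R}^{n\times k}$ only by a $\lambda_{\mathbb{R}^{n\times k}}$-null set. 2. Suppose $k\ge2$ and $n\ge4$, and suppose $X$ is of the form $X=(e_+,\tilde X)$. For $e\in\{e_+,e_-\}$ define $\tilde{\mathfrak{X}}_{1,FGLS}(e)=\{\tilde X\in\tilde{\mathfrak{X}}_0:e\in N_{2,(e_+,\tilde X)}^*(a_1,a_2)\}$ and $\tilde{\mathfrak{X}}_{2,FGLS}(e)=\{\tilde X\in\tilde{\mathfrak{X}}_0\setminus\tilde{\mathfrak{X}}_{1,FGLS}(e):T_{FGLS,(e_+,\tilde X)}(e+\mu_0^* )=C\}$, where $\mu_0^*\in\mathfrak{M}_{0,(e_+,\tilde X)}$ is arbitrary (the latter set does not depend on the choice of $\mu_0^*$). Then $\tilde{\mathfrak{X}}_{1,FGLS}(e_-)$ is a $\lambda_{\mathbb{R}^{n\times(k-1)}}$-null set. The set $\tilde{\mathfrak{X}}_{2,FGLS}(e_-)$ is a $\lambda_{\mathbb{R}^{n\times(k-1)}}$-null set under the provision that it is a proper subset of $\tilde{\mathfrak{X}}_0\setminus\tilde{\mathfrak{X}}_{1,FGLS}(e_-)$. Moreover $\tilde{\mathfrak{X}}_{1,FGLS}(e_+)=\tilde{\mathfrak{X}}_0$ and $\tilde{\mathfrak{X}}_{2,FGLS}(e_+)=\emptyset$. The set of all $\tilde X\in\tilde{\mathfrak{X}}_0$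 such that $X=(e_+,\tilde X)$ is not FGLS-covered is a subset of $\tilde{\mathfrak{X}}_{1,FGLS}(e_-)\cup\tilde{\mathfrak{X}}_{2,FGLS}(e_-)$ and hence is a $\lambda_{\mathbb{R}^{n\times(k-1)}}$-null set under the preceding provision; moreover $\tilde{\mathfrak{X}}_0$ differs from $\mathbb{R}^{n\times(k-1)}$ only by a $\lambda_{\mathbb{R}^{n\times(k-1)}}$-null set. 3. Define $\mathfrak{X}_{1,OLS}(\cdot)$, $\mathfrak{X}_{2,OLS}(\cdot)$, $\tilde{\mathfrak{X}}_{1,OLS}(\cdot)$, $\tilde{\mathfrak{X}}_{2,OLS}(\cdot)$ in the same way but with $N_{0,X}^*(a_1,a_2)$ replacing $N_{2,X}^*(a_1,a_2)$ and $T_{OLS,X}$ replacing $T_{FGLS,X}$. Then item 1 holds for $\mathfrak{X}_{1,OLS}(\cdot)$ and $\mathfrak{X}_{2,OLS}(\cdot)$, and item 2 holds for $\tilde{\mathfrak{X}}_{1,OLS}(\cdot)$ and $\tilde{\mathfrak{X}}_{2,OLS}(\cdot)$, with "FGLS-covered" replaced by "OLS-covered" (and all subscripts $FGLS$ replaced by $OLS$). 4. Suppose $X=(e_+,\tilde X)$ and the first column of $R$ is nonzero. Then for every $\tilde X\in\tilde{\mathfrak{X}}_0$ the matrix $X=(e_+,\tilde X)$ is FGLS-covered as well as OLS-covered through condition (iii) with $e=e_+$ of the definition of covered matrices given in the context.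
   Context: $n,k,q$ are integers with $1\le k<n$, $q\ge1$; $R$ is a real $q\times k$ matrix of rank $q$, $r\in\mathbb{R}^q$. $\mathfrak{C}$ is a nonempty set of symmetric positive definite $n\times n$ matrices (such that $\sigma^2\in(0,\infty)$ and $\Sigma\in\mathfrak{C}$ are uniquely determined by $\sigma^2\Sigma$). $\Lambda(\rho)$ is the $n\times n$ matrix with $(i,j)$ entry $\rho^{|i-j|}$, $\rho\in\mathbb{R}$; $\mathfrak{C}_{AR(1)}=\{\Lambda(\rho):\rho\in(-1,1)\}$. $e_+=(1,\dots,1)'$, $e_-=(-1,1,\dots,(-1)^n)'$ in $\mathbb{R}^n$. $\lambda$ denotes Lebesgue measure on the indicated space. $\mathfrak{X}_0=\{X\in\mathbb{R}^{n\times k}:\operatorname{rank}(X)=k\}$; $\tilde{\mathfrak{X}}_0=\{\tilde X\in\mathbb{R}^{n\times(k-1)}:\operatorname{rank}((e_+,\tilde X))=k\}$. For $X\in\mathfrak{X}_0$: $\mathfrak{M}_{0,X}=\{X\beta:\beta\in\mathbb{R}^k,R\beta=r\}$, $\hat\beta_X(y)=(X'X)^{-1}X'y$, $\hat u(y)=y-X\hat\beta_X(y)$ with coordinates $\hat u_t(y)$ (all quantities below depend on $X$; subscripts $X$ indicate this where needed). $N_{0,X}(a_1,a_2)=\{y:\sum_{t=a_1}^{a_2}\hat u_t^2(y)=0\}$; $\hat\rho(y)=\sum_{t=2}^n\hat u_t(y)\hat u_{t-1}(y)/\sum_{t=a_1}^{a_2}\hat u_t^2(y)$ for $y\notin N_{0,X}(a_1,a_2)$;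 $N_{1,X}(a_1,a_2)=\{y:|\sum_{t=2}^n\hat u_t(y)\hat u_{t-1}(y)|=\sum_{t=a_1}^{a_2}\hat u_t^2(y)\}$; $\mathbb{R}^n\setminus N_{2,X}(a_1,a_2)=\{y\notin N_{1,X}(a_1,a_2):\det(X'\Lambda^{-1}(\hat\rho(y))X)\ne0\}$. On $\mathbb{R}^n\setminus N_{2,X}(a_1,a_2)$: $\tilde\beta(y)=(X'\Lambda^{-1}(\hat\rho(y))X)^{-1}X'\Lambda^{-1}(\hat\rho(y))y$, $\tilde\sigma^2(y)=(n-k)^{-1}(y-X\tilde\beta(y))'\Lambda^{-1}(\hat\rho(y))(y-X\tilde\beta(y))$, $\tilde\Omega(y)=\tilde\sigma^2(y)R(X'\Lambda^{-1}(\hat\rho(y))X)^{-1}R'$. $\mathbb{R}^n\setminus N_{2,X}^*(a_1,a_2)=\{y\notin N_{2,X}(a_1,a_2):\tilde\sigma^2(y)\ne0,\det(R(X'\Lambda^{-1}(\hat\rho(y))X)^{-1}R')\ne0\}$. $T_{FGLS,X}(y)=(R\tilde\beta(y)-r)'\tilde\Omega^{-1}(y)(R\tilde\beta(y)-r)$ for $y\notin N_{2,X}^*(a_1,a_2)$ and $0$ otherwise. $\mathbb{R}^n\setminus N_{0,X}^*(a_1,a_2)=\{y\notin N_{0,X}(a_1,a_2):\det(R(X'X)^{-1}X'\Lambda(\hat\rho(y))X(X'X)^{-1}R')\ne0\}$; $\hat\sigma^2(y)=(n-k)^{-1}\hat u(y)'\hat u(y)$; $\hat\Omega(y)=\hat\sigma^2(y)R(X'X)^{-1}X'\Lambda(\hat\rho(y))X(X'X)^{-1}R'$;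 $T_{OLS,X}(y)=(R\hat\beta_X(y)-r)'\hat\Omega^{-1}(y)(R\hat\beta_X(y)-r)$ for $y\notin N_{0,X}^*(a_1,a_2)$ and $0$ otherwise. Covered matrices (i.e. those to which the paper's theorem on size/power deficiencies applies): $X\in\mathfrak{X}_0$ is FGLS-covered if for at least one $e\in\{e_+,e_-\}$ one of the following holds: (i) $e\notin N_{2,X}^*(a_1,a_2)$ and $T_{FGLS,X}(e+\mu_0^* )>C$ for some (equivalently all) $\mu_0^*\in\mathfrak{M}_{0,X}$; (ii) $e\notin N_{2,X}^*(a_1,a_2)$ and $T_{FGLS,X}(e+\mu_0^* )<C$ for some (equivalently all) $\mu_0^*\in\mathfrak{M}_{0,X}$; (iii) $e\in\operatorname{span}(X)$ and $R\hat\beta_X(e)\ne0$. OLS-covered is defined in the same way with $N_{0,X}^*(a_1,a_2)$ and $T_{OLS,X}$ in place of $N_{2,X}^*(a_1,a_2)$ and $T_{FGLS,X}$. *)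

theory Defs
  imports
    "HOL-Analysis.Lebesgue_Measure"
    "HOL-Analysis.Embed_Measure"
    "Jordan_Normal_Form.DL_Rank"
    "Jordan_Normal_Form.Gauss_Jordan_Elimination"
begin

text \<open>
  Matrices and vectors are those of Jordan_Normal_Form, so that n, k and q are ordinary natural
  numbers. Entries are indexed from 0: the t-th coordinate of u (t = 1, ..., n) is
  \<open>vec_index u (t - 1)\<close>.
\<close>

section \<open>Lebesgue measure on matrices\<close>

definition lebesgue_mat :: "nat \<Rightarrow> nat \<Rightarrow> real mat measure" where
  "lebesgue_mat n k =
     embed_measure (completion (\<Pi>\<^sub>M ij \<in> {..<n} \<times> {..<k}. (lborel :: real measure))) (mat n k)"

lemma inj_on_mat_PiE: "inj_on (mat n k) (({..<n} \<times> {..<k}) \<rightarrow>\<^sub>E (UNIV :: real set))"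
proof (rule inj_onI)
  fix f g :: "nat \<times> nat \<Rightarrow> real"
  assume f: "f \<in> ({..<n} \<times> {..<k}) \<rightarrow>\<^sub>E UNIV" and g: "g \<in> ({..<n} \<times> {..<k}) \<rightarrow>\<^sub>E UNIV"
    and eq: "mat n k f = mat n k g"
  show "f = g"
  proof (rule PiE_ext[OF f g])
    fix x assume "x \<in> {..<n} \<times> {..<k}"
    then obtain i j where x: "x = (i, j)" "i < n" "j < k" by auto
    from eq have "index_mat (mat n k f) (i, j) = index_mat (mat n k g) (i, j)" by simp
    with x show "f x = g x" by simp
  qed
qed

lemma mat_image_PiE: "mat n k ` (({..<n} \<times> {..<k}) \<rightarrow>\<^sub>E (UNIV :: real set)) = carrier_mat n k"
proof (intro equalityI subsetI)
  fix A :: "real mat" assume A: "A \<in> carrier_mat n k"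
  have "A = mat n k (restrict (index_mat A) ({..<n} \<times> {..<k}))"
    using A by (intro eq_matI) auto
  then show "A \<in> mat n k ` (({..<n} \<times> {..<k}) \<rightarrow>\<^sub>E (UNIV :: real set))"
    by (metis (no_types, lifting) imageI UNIV_I restrict_PiE_iff)
qed auto

lemma space_lebesgue_mat: "space (lebesgue_mat n k) = carrier_mat n k"
  by (simp add: lebesgue_mat_def space_embed_measure space_PiM mat_image_PiE)

lemma null_sets_lebesgue_mat_iff:
  "A \<in> null_sets (lebesgue_mat n k) \<longleftrightarrow>
     A \<subseteq> carrier_mat n k \<and>
     {f \<in> ({..<n} \<times> {..<k}) \<rightarrow>\<^sub>E UNIV. mat n k f \<in> A}
       \<in> null_sets (completion (\<Pi>\<^sub>M ij \<in> {..<n} \<times> {..<k}. (lborel :: real measure)))"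
proof -
  define M where "M = completion (\<Pi>\<^sub>M ij \<in> {..<n} \<times> {..<k}. (lborel :: real measure))"
  have sp: "space M = ({..<n} \<times> {..<k}) \<rightarrow>\<^sub>E UNIV" by (simp add: M_def space_PiM)
  have inj: "inj_on (mat n k) (space M)" unfolding sp by (rule inj_on_mat_PiE)
  have img: "mat n k ` space M = carrier_mat n k" unfolding sp by (rule mat_image_PiE)
  have pre: "{f \<in> ({..<n} \<times> {..<k}) \<rightarrow>\<^sub>E UNIV. mat n k f \<in> A} = mat n k -` A \<inter> space M"
    using sp by auto
  have L: "lebesgue_mat n k = embed_measure M (mat n k)" by (simp add: lebesgue_mat_def M_def)
  have s: "A \<in> sets (lebesgue_mat n k) \<longleftrightarrow>
      A \<subseteq> carrier_mat n k \<and> mat n k -` A \<inter> space M \<in> sets M"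
  proof
    assume "A \<in> sets (lebesgue_mat n k)"
    then obtain B where B: "B \<in> sets M" "A = mat n k ` B"
      unfolding L sets_embed_measure'[OF inj] by auto
    have Bs: "B \<subseteq> space M" using B(1) by (rule sets.sets_into_space)
    have "mat n k -` A \<inter> space M = B" using B(2) Bs inj by (auto dest: inj_onD)
    then show "A \<subseteq> carrier_mat n k \<and> mat n k -` A \<inter> space M \<in> sets M"
      using B Bs img by auto
  next
    assume a: "A \<subseteq> carrier_mat n k \<and> mat n k -` A \<inter> space M \<in> sets M"
    have "mat n k ` (mat n k -` A \<inter> space M) = A \<inter> mat n k ` space M" by auto
    with a have "A = mat n k ` (mat n k -` A \<inter> space M)"
      unfolding img by (simp add: Int_absorb2)
    with a have "\<exists>B. A = mat n k ` B \<and> B \<in> sets M" by (intro exI conjI) auto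
    then show "A \<in> sets (lebesgue_mat n k)"
      unfolding L sets_embed_measure'[OF inj] by (rule CollectI)
  qed
  have em: "emeasure (lebesgue_mat n k) A = emeasure M (mat n k -` A \<inter> space M)"
    if "A \<in> sets (lebesgue_mat n k)"
    using that unfolding L by (rule emeasure_embed_measure'[OF inj])
  have "A \<in> null_sets (lebesgue_mat n k) \<longleftrightarrow>
      A \<subseteq> carrier_mat n k \<and> mat n k -` A \<inter> space M \<in> null_sets M"
    unfolding null_sets_def mem_Collect_eq using s em by metis
  then show ?thesis
    unfolding pre M_def .
qed

section \<open>The model\<close>

abbreviation mat_rank :: "real mat \<Rightarrow> nat" where
  "mat_rank A \<equiv> vec_space.rank (dim_row A) A"

text \<open>The inverse matrix; unspecified for a singular argument.\<close>

definition minv :: "real mat \<Rightarrow> real mat" where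
  "minv A = the (mat_inverse A)"

lemma minv:
  assumes A: "A \<in> carrier_mat m m" and "det A \<noteq> 0"
  shows "minv A \<in> carrier_mat m m" "A * minv A = 1\<^sub>m m" "minv A * A = 1\<^sub>m m"
proof -
  have "A \<in> Units (ring_mat TYPE(real) m undefined)"
    using det_non_zero_imp_unit[OF A \<open>det A \<noteq> 0\<close>] .
  then obtain B where "mat_inverse A = Some B"
    using mat_inverse(1)[OF A, where b = undefined] by (cases "mat_inverse A") auto
  with mat_inverse(2)[OF A this]
  show "minv A \<in> carrier_mat m m" "A * minv A = 1\<^sub>m m" "minv A * A = 1\<^sub>m m"
    by (auto simp: minv_def)
qed

definition pos_def_mat :: "nat \<Rightarrow> real mat \<Rightarrow> bool" where
  "pos_def_mat n A \<longleftrightarrow> A \<in> carrier_mat n n \<and> transpose_mat A = A \<and>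
     (\<forall>x \<in> carrier_vec n. x \<noteq> 0\<^sub>v n \<longrightarrow> scalar_prod x (A *\<^sub>v x) > 0)"

text \<open>The last clause says that \<open>\<sigma>\<^sup>2\<close> and \<open>\<Sigma>\<close> are determined by \<open>\<sigma>\<^sup>2\<Sigma>\<close>; \<open>s\<^sub>1\<close>, \<open>s\<^sub>2\<close> are values of \<open>\<sigma>\<^sup>2\<close>.\<close>

definition covariance_model :: "nat \<Rightarrow> real mat set \<Rightarrow> bool" where
  "covariance_model n CC \<longleftrightarrow> CC \<noteq> {} \<and> (\<forall>S \<in> CC. pos_def_mat n S) \<and>
     (\<forall>s\<^sub>1 s\<^sub>2. \<forall>S\<^sub>1 \<in> CC. \<forall>S\<^sub>2 \<in> CC.
        0 < s\<^sub>1 \<longrightarrow> 0 < s\<^sub>2 \<longrightarrow> s\<^sub>1 \<cdot>\<^sub>m S\<^sub>1 = s\<^sub>2 \<cdot>\<^sub>m S\<^sub>2 \<longrightarrow> s\<^sub>1 = s\<^sub>2 \<and> S\<^sub>1 = S\<^sub>2)"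

definition Lam :: "nat \<Rightarrow> real \<Rightarrow> real mat" where
  "Lam n \<rho> = mat n n (\<lambda>(i, j). \<rho> ^ nat \<bar>int i - int j\<bar>)"

definition C_AR1 :: "nat \<Rightarrow> real mat set" where
  "C_AR1 n = {Lam n \<rho> | \<rho>. -1 < \<rho> \<and> \<rho> < 1}"

definition e_plus :: "nat \<Rightarrow> real vec" where
  "e_plus n = vec n (\<lambda>i. 1)"

definition e_minus :: "nat \<Rightarrow> real vec" where
  "e_minus n = vec n (\<lambda>i. (-1) ^ (i + 1))"

definition with_intercept :: "nat \<Rightarrow> real mat \<Rightarrow> real mat" where
  "with_intercept n Xt = mat_of_cols n (e_plus n # cols Xt)"

definition null_means :: "real mat \<Rightarrow> real vec \<Rightarrow> real mat \<Rightarrow> real vec set" where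
  "null_means R r X = {X *\<^sub>v \<beta> | \<beta>. \<beta> \<in> carrier_vec (dim_col X) \<and> R *\<^sub>v \<beta> = r}"

section \<open>OLS and FGLS quantities\<close>

text \<open>Throughout, n and k are the numbers of rows and columns of X.\<close>

definition beta_hat :: "real mat \<Rightarrow> real vec \<Rightarrow> real vec" where
  "beta_hat X y = minv (transpose_mat X * X) *\<^sub>v (transpose_mat X *\<^sub>v y)"

definition u_hat :: "real mat \<Rightarrow> real vec \<Rightarrow> real vec" where
  "u_hat X y = y - X *\<^sub>v beta_hat X y"

definition rho_num :: "real mat \<Rightarrow> real vec \<Rightarrow> real" where
  "rho_num X y = (\<Sum>t = 2..dim_row X. vec_index (u_hat X y) (t - 1) * vec_index (u_hat X y) (t - 2))"

definition rho_den :: "nat \<Rightarrow> nat \<Rightarrow> real mat \<Rightarrow> real vec \<Rightarrow> real" where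
  "rho_den a\<^sub>1 a\<^sub>2 X y = (\<Sum>t = a\<^sub>1..a\<^sub>2. (vec_index (u_hat X y) (t - 1))\<^sup>2)"

definition rho_hat :: "nat \<Rightarrow> nat \<Rightarrow> real mat \<Rightarrow> real vec \<Rightarrow> real" where
  "rho_hat a\<^sub>1 a\<^sub>2 X y = rho_num X y / rho_den a\<^sub>1 a\<^sub>2 X y"

definition Lam_hat :: "nat \<Rightarrow> nat \<Rightarrow> real mat \<Rightarrow> real vec \<Rightarrow> real mat" where
  "Lam_hat a\<^sub>1 a\<^sub>2 X y = Lam (dim_row X) (rho_hat a\<^sub>1 a\<^sub>2 X y)"

definition N0 :: "nat \<Rightarrow> nat \<Rightarrow> real mat \<Rightarrow> real vec set" where
  "N0 a\<^sub>1 a\<^sub>2 X = {y \<in> carrier_vec (dim_row X). rho_den a\<^sub>1 a\<^sub>2 X y = 0}"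

definition N1 :: "nat \<Rightarrow> nat \<Rightarrow> real mat \<Rightarrow> real vec set" where
  "N1 a\<^sub>1 a\<^sub>2 X = {y \<in> carrier_vec (dim_row X). \<bar>rho_num X y\<bar> = rho_den a\<^sub>1 a\<^sub>2 X y}"

definition gls_gram :: "nat \<Rightarrow> nat \<Rightarrow> real mat \<Rightarrow> real vec \<Rightarrow> real mat" where
  "gls_gram a\<^sub>1 a\<^sub>2 X y = transpose_mat X * minv (Lam_hat a\<^sub>1 a\<^sub>2 X y) * X"

definition N2 :: "nat \<Rightarrow> nat \<Rightarrow> real mat \<Rightarrow> real vec set" where
  "N2 a\<^sub>1 a\<^sub>2 X = carrier_vec (dim_row X) -
     {y \<in> carrier_vec (dim_row X). y \<notin> N1 a\<^sub>1 a\<^sub>2 X \<and> det (gls_gram a\<^sub>1 a\<^sub>2 X y) \<noteq> 0}"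

definition beta_tilde :: "nat \<Rightarrow> nat \<Rightarrow> real mat \<Rightarrow> real vec \<Rightarrow> real vec" where
  "beta_tilde a\<^sub>1 a\<^sub>2 X y =
     minv (gls_gram a\<^sub>1 a\<^sub>2 X y) *\<^sub>v (transpose_mat X *\<^sub>v (minv (Lam_hat a\<^sub>1 a\<^sub>2 X y) *\<^sub>v y))"

definition sigma2_tilde :: "nat \<Rightarrow> nat \<Rightarrow> real mat \<Rightarrow> real vec \<Rightarrow> real" where
  "sigma2_tilde a\<^sub>1 a\<^sub>2 X y =
     (let u = y - X *\<^sub>v beta_tilde a\<^sub>1 a\<^sub>2 X y
      in scalar_prod u (minv (Lam_hat a\<^sub>1 a\<^sub>2 X y) *\<^sub>v u) / real (dim_row X - dim_col X))"

definition Omega_tilde :: "nat \<Rightarrow> nat \<Rightarrow> real mat \<Rightarrow> real mat \<Rightarrow> real vec \<Rightarrow> real mat" where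
  "Omega_tilde a\<^sub>1 a\<^sub>2 R X y =
     sigma2_tilde a\<^sub>1 a\<^sub>2 X y \<cdot>\<^sub>m (R * minv (gls_gram a\<^sub>1 a\<^sub>2 X y) * transpose_mat R)"

definition N2_star :: "nat \<Rightarrow> nat \<Rightarrow> real mat \<Rightarrow> real mat \<Rightarrow> real vec set" where
  "N2_star a\<^sub>1 a\<^sub>2 R X = carrier_vec (dim_row X) -
     {y \<in> carrier_vec (dim_row X). y \<notin> N2 a\<^sub>1 a\<^sub>2 X \<and> sigma2_tilde a\<^sub>1 a\<^sub>2 X y \<noteq> 0 \<and>
        det (R * minv (gls_gram a\<^sub>1 a\<^sub>2 X y) * transpose_mat R) \<noteq> 0}"

definition T_FGLS :: "nat \<Rightarrow> nat \<Rightarrow> real mat \<Rightarrow> real vec \<Rightarrow> real mat \<Rightarrow> real vec \<Rightarrow> real" where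
  "T_FGLS a\<^sub>1 a\<^sub>2 R r X y =
     (if y \<notin> N2_star a\<^sub>1 a\<^sub>2 R X
      then let d = R *\<^sub>v beta_tilde a\<^sub>1 a\<^sub>2 X y - r
           in scalar_prod d (minv (Omega_tilde a\<^sub>1 a\<^sub>2 R X y) *\<^sub>v d)
      else 0)"

definition ols_sandwich :: "nat \<Rightarrow> nat \<Rightarrow> real mat \<Rightarrow> real mat \<Rightarrow> real vec \<Rightarrow> real mat" where
  "ols_sandwich a\<^sub>1 a\<^sub>2 R X y =
     R * minv (transpose_mat X * X) * transpose_mat X * Lam_hat a\<^sub>1 a\<^sub>2 X y
       * X * minv (transpose_mat X * X) * transpose_mat R"

definition N0_star :: "nat \<Rightarrow> nat \<Rightarrow> real mat \<Rightarrow> real mat \<Rightarrow> real vec set" where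
  "N0_star a\<^sub>1 a\<^sub>2 R X = carrier_vec (dim_row X) -
     {y \<in> carrier_vec (dim_row X). y \<notin> N0 a\<^sub>1 a\<^sub>2 X \<and> det (ols_sandwich a\<^sub>1 a\<^sub>2 R X y) \<noteq> 0}"

definition sigma2_hat :: "real mat \<Rightarrow> real vec \<Rightarrow> real" where
  "sigma2_hat X y = scalar_prod (u_hat X y) (u_hat X y) / real (dim_row X - dim_col X)"

definition Omega_hat :: "nat \<Rightarrow> nat \<Rightarrow> real mat \<Rightarrow> real mat \<Rightarrow> real vec \<Rightarrow> real mat" where
  "Omega_hat a\<^sub>1 a\<^sub>2 R X y = sigma2_hat X y \<cdot>\<^sub>m ols_sandwich a\<^sub>1 a\<^sub>2 R X y"

definition T_OLS :: "nat \<Rightarrow> nat \<Rightarrow> real mat \<Rightarrow> real vec \<Rightarrow> real mat \<Rightarrow> real vec \<Rightarrow> real" where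
  "T_OLS a\<^sub>1 a\<^sub>2 R r X y =
     (if y \<notin> N0_star a\<^sub>1 a\<^sub>2 R X
      then let d = R *\<^sub>v beta_hat X y - r
           in scalar_prod d (minv (Omega_hat a\<^sub>1 a\<^sub>2 R X y) *\<^sub>v d)
      else 0)"

section \<open>Covered and exceptional design matrices\<close>

text \<open>
  The following notions are parameterised by the exceptional set N and the test statistic T,
  both depending on X; they are used with (\<open>N2_star\<close>, \<open>T_FGLS\<close>) and (\<open>N0_star\<close>, \<open>T_OLS\<close>).
\<close>

definition cover_iii :: "real mat \<Rightarrow> real mat \<Rightarrow> real vec \<Rightarrow> bool" where
  "cover_iii R X e \<longleftrightarrow>
     e \<in> vec_space.col_space (dim_row X) X \<and> R *\<^sub>v beta_hat X e \<noteq> 0\<^sub>v (dim_row R)"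

definition covered :: "real mat \<Rightarrow> real vec \<Rightarrow> real \<Rightarrow> (real mat \<Rightarrow> real vec set) \<Rightarrow>
    (real mat \<Rightarrow> real vec \<Rightarrow> real) \<Rightarrow> real mat \<Rightarrow> bool" where
  "covered R r C N T X \<longleftrightarrow>
     (\<exists>e \<in> {e_plus (dim_row X), e_minus (dim_row X)}.
        (e \<notin> N X \<and> (\<exists>\<mu> \<in> null_means R r X. T X (e + \<mu>) > C)) \<or>
        (e \<notin> N X \<and> (\<exists>\<mu> \<in> null_means R r X. T X (e + \<mu>) < C)) \<or>
        cover_iii R X e)"

definition XX0 :: "nat \<Rightarrow> nat \<Rightarrow> real mat set" where
  "XX0 n k = {X \<in> carrier_mat n k. mat_rank X = k}"

definition XX1 :: "nat \<Rightarrow> nat \<Rightarrow> (real mat \<Rightarrow> real vec set) \<Rightarrow> real vec \<Rightarrow> real mat set" where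
  "XX1 n k N e = {X \<in> XX0 n k. e \<in> N X}"

text \<open>
  \<open>T X (e + \<mu>)\<close> does not depend on the choice of \<open>\<mu> \<in> null_means R r X\<close> for the two statistics
  considered, so "some" may be read as "all" here, in \<open>covered\<close> and in \<open>XXt2\<close>.
\<close>

definition XX2 :: "nat \<Rightarrow> nat \<Rightarrow> real mat \<Rightarrow> real vec \<Rightarrow> real \<Rightarrow> (real mat \<Rightarrow> real vec set) \<Rightarrow>
    (real mat \<Rightarrow> real vec \<Rightarrow> real) \<Rightarrow> real vec \<Rightarrow> real mat set" where
  "XX2 n k R r C N T e =
     {X \<in> XX0 n k - XX1 n k N e. \<exists>\<mu> \<in> null_means R r X. T X (e + \<mu>) = C}"

definition XXt0 :: "nat \<Rightarrow> nat \<Rightarrow> real mat set" where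
  "XXt0 n k = {Xt \<in> carrier_mat n (k - 1). mat_rank (with_intercept n Xt) = k}"

definition XXt1 :: "nat \<Rightarrow> nat \<Rightarrow> (real mat \<Rightarrow> real vec set) \<Rightarrow> real vec \<Rightarrow> real mat set" where
  "XXt1 n k N e = {Xt \<in> XXt0 n k. e \<in> N (with_intercept n Xt)}"

definition XXt2 :: "nat \<Rightarrow> nat \<Rightarrow> real mat \<Rightarrow> real vec \<Rightarrow> real \<Rightarrow> (real mat \<Rightarrow> real vec set) \<Rightarrow>
    (real mat \<Rightarrow> real vec \<Rightarrow> real) \<Rightarrow> real vec \<Rightarrow> real mat set" where
  "XXt2 n k R r C N T e =
     {Xt \<in> XXt0 n k - XXt1 n k N e.
        \<exists>\<mu> \<in> null_means R r (with_intercept n Xt). T (with_intercept n Xt) (e + \<mu>) = C}"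

end

theory Submission
  imports Defs
begin

text \<open>
  Fix a vector \<open>e\<close>. Where the inverses and quotients involved exist, every quantity that enters the
  exceptional set and the test statistic at \<open>e\<close> is a rational function of the entries of the design
  \<open>X\<close>: sums, products, quotients by nonzero quantities, and inverses of nonsingular matrices (adjugate
  over determinant) do not leave this class. A rational function that does not vanish identically
  has a null set of zeros, because its numerator is a nonzero polynomial. So the designs at which a
  nonvanishing condition (full rank, \<open>rho_den \<noteq> 0\<close>, \<open>rho_num\<^sup>2 \<noteq> rho_den\<^sup>2\<close>, nonsingularity of a Gram
  or sandwich matrix, \<open>sigma2_tilde \<noteq> 0\<close>) first fails form a null set as soon as a \<^emph>\<open>single\<close> design
  satisfies all the conditions.

  A design of full rank satisfies them all if its estimated autocorrelation lies strictly between -1 and 1: then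
  \<open>Lam\<close> at this value is positive definite, and so are the Gram matrix, its inverse, and their images
  under the full row rank restriction \<open>R\<close> (lemma \<open>regular_if_rho_lt_1\<close>). Such a design is found by
  prescribing the OLS residual \<open>u\<close> of \<open>e\<close>: if \<open>u\<close> is orthogonal to \<open>e - u\<close>, any full rank \<open>X\<close> whose
  columns are orthogonal to \<open>u\<close> and whose span contains \<open>e - u\<close> has residual \<open>u\<close>. For free \<open>X\<close> one
  nonzero coordinate of \<open>u\<close> suffices (lemma \<open>rho_bounded_design\<close>). With an intercept, \<open>u\<close> must also be
  orthogonal to \<open>e_plus\<close>; for \<open>e = e_minus\<close> the choice \<open>u = (-1, 0, 0, 1, 0, \<dots>)\<close> works
  (lemma \<open>rho_bounded_intercept_design\<close>). In both cases no two neighbouring residuals are nonzero, so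
  \<open>rho_num = 0\<close>.

  The statistic at \<open>e + X b\<close> with \<open>R b = r\<close> depends on \<open>e\<close> alone, because residuals are unchanged and
  coefficients move by \<open>b\<close> when \<open>X b\<close> is added to the data. Hence the choice of the null mean does not
  matter, and the event that the statistic equals \<open>C\<close> is again the zero set of a rational function: it
  is null unless it contains every regular design. A design that is not covered has, at each \<open>e\<close>
  outside the exceptional set, a statistic that is neither above nor below \<open>C\<close>. Finally a vector
  in the span of \<open>X\<close> has zero residuals and is always exceptional, which settles \<open>e_plus\<close> for
  designs with an intercept; its OLS coefficient is the first unit vector, so that a nonzero first
  column of \<open>R\<close> gives coverage.
\<close>

\<comment> \<open>From here on the product sign and the index sign are those of matrices and vectors of variable
   dimension.\<close>
unbundle no vec_syntax
unbundle no inner_syntax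

section \<open>Zero sets of polynomial and rational functions\<close>

inductive poly_fun :: "'i set \<Rightarrow> (('i \<Rightarrow> real) \<Rightarrow> real) \<Rightarrow> bool" for I where
  const: "poly_fun I (\<lambda>_. c)"
| coord: "i \<in> I \<Longrightarrow> poly_fun I (\<lambda>f. f i)"
| add: "poly_fun I p \<Longrightarrow> poly_fun I s \<Longrightarrow> poly_fun I (\<lambda>f. p f + s f)"
| mult: "poly_fun I p \<Longrightarrow> poly_fun I s \<Longrightarrow> poly_fun I (\<lambda>f. p f * s f)"

lemma poly_fun_measurable:
  "poly_fun I p \<Longrightarrow> p \<in> borel_measurable (\<Pi>\<^sub>M i \<in> I. (lborel :: real measure))"
proof (induction rule: poly_fun.induct)
  case (coord i)
  then have "(\<lambda>f. f i) \<in> measurable (\<Pi>\<^sub>M i \<in> I. (lborel :: real measure)) lborel"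
    by (rule measurable_component_singleton)
  then show ?case by simp
qed auto

lemma poly_fun_upd: "poly_fun (insert i I) p \<Longrightarrow> poly_fun I (\<lambda>f. p (f(i := c)))"
proof (induction rule: poly_fun.induct)
  case (coord j)
  then show ?case by (cases "j = i") (auto intro: poly_fun.intros)
qed (auto intro: poly_fun.intros)

lemma poly_fun_line: "poly_fun I p \<Longrightarrow> \<exists>P. \<forall>t. p (f(i := t)) = poly P t"
proof (induction rule: poly_fun.induct)
  case (const c)
  show ?case by (rule exI[of _ "[:c:]"]) simp
next
  case (coord j)
  show ?case
  proof (cases "j = i")
    case True
    then show ?thesis by (intro exI[of _ "[:0, 1:]"]) simp
  next
    case False
    then show ?thesis by (intro exI[of _ "[:f j:]"]) simp
  qed
next
  case (add p s)
  then obtain P S where "\<forall>t. p (f(i := t)) = poly P t" "\<forall>t. s (f(i := t)) = poly S t" by blast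
  then show ?case by (intro exI[of _ "P + S"]) (simp del: fun_upd_apply)
next
  case (mult p s)
  then obtain P S where "\<forall>t. p (f(i := t)) = poly P t" "\<forall>t. s (f(i := t)) = poly S t" by blast
  then show ?case by (intro exI[of _ "P * S"]) (simp del: fun_upd_apply)
qed

text \<open>
  Induction on the number of variables. If \<open>p\<close> does not vanish at \<open>f\<^sub>0\<close>, then by induction almost
  every \<open>g\<close> in the remaining variables has \<open>p \<noteq> 0\<close> when completed by the value \<open>f\<^sub>0 i\<close> of the
  variable \<open>i\<close>; on the line through such a \<open>g\<close> in direction \<open>i\<close> the function is a nonzero
  univariate polynomial with finitely many roots. Fubini's theorem finishes the step.
\<close>

theorem poly_fun_zeros_null:
  assumes "finite I" and "poly_fun I p" and "f\<^sub>0 \<in> I \<rightarrow>\<^sub>E UNIV" and "p f\<^sub>0 \<noteq> 0"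
  shows "{f \<in> I \<rightarrow>\<^sub>E UNIV. p f = 0} \<in> null_sets (\<Pi>\<^sub>M i \<in> I. (lborel :: real measure))"
  using assms
proof (induction I arbitrary: p f\<^sub>0 rule: finite_induct)
  case empty
  then have "{f \<in> {} \<rightarrow>\<^sub>E UNIV. p f = 0} = {}" by auto
  then show ?case by (metis null_sets.empty_sets)
next
  case (insert i I)
  interpret product_sigma_finite "\<lambda>_. lborel :: real measure" by standard
  let ?M = "\<lambda>I. \<Pi>\<^sub>M i \<in> I. (lborel :: real measure)"
  let ?Z = "{f \<in> insert i I \<rightarrow>\<^sub>E UNIV. p f = 0}"
  have meas: "?Z \<in> sets (?M (insert i I))"
  proof -
    have "{f \<in> space (?M (insert i I)). p f = 0} \<in> sets (?M (insert i I))"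
      using poly_fun_measurable[OF insert.prems(1)] by measurable
    then show ?thesis by (simp add: space_PiM)
  qed
  define g\<^sub>0 where "g\<^sub>0 = f\<^sub>0(i := undefined)"
  have g0: "g\<^sub>0 \<in> I \<rightarrow>\<^sub>E UNIV"
    using insert.prems(2) insert.hyps(2) by (auto simp: g\<^sub>0_def PiE_def extensional_def)
  have "{g \<in> I \<rightarrow>\<^sub>E UNIV. p (g(i := f\<^sub>0 i)) = 0} \<in> null_sets (?M I)"
  proof (rule insert.IH[OF poly_fun_upd[OF insert.prems(1)] g0])
    show "p (g\<^sub>0(i := f\<^sub>0 i)) \<noteq> 0" using insert.prems(3) by (simp add: g\<^sub>0_def)
  qed
  then have ae: "AE g in ?M I. p (g(i := f\<^sub>0 i)) \<noteq> 0"
    by (rule AE_I') (auto simp: space_PiM)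
  have inner: "(\<integral>\<^sup>+ t. indicator ?Z (g(i := t)) \<partial>lborel) = 0"
    if g: "g \<in> space (?M I)" and nz: "p (g(i := f\<^sub>0 i)) \<noteq> 0" for g
  proof -
    obtain P where P: "\<forall>t. p (g(i := t)) = poly P t" using poly_fun_line[OF insert.prems(1)] by blast
    with nz have "P \<noteq> 0" by auto
    then have fin: "finite {t. poly P t = 0}" by (rule poly_roots_finite)
    have "(\<integral>\<^sup>+ t. indicator ?Z (g(i := t)) \<partial>lborel) = (\<integral>\<^sup>+ t. indicator {t. poly P t = 0} t \<partial>lborel)"
      using g P by (intro nn_integral_cong) (auto simp: indicator_def space_PiM PiE_def extensional_def)
    also have "\<dots> = emeasure lborel {t. poly P t = 0}"
      using fin by (intro nn_integral_indicator) (simp add: borel_closed finite_imp_closed)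
    also have "\<dots> = 0" using fin by (simp add: emeasure_lborel_countable countable_finite)
    finally show ?thesis .
  qed
  have "emeasure (?M (insert i I)) ?Z = (\<integral>\<^sup>+ f. indicator ?Z f \<partial>?M (insert i I))"
    using meas by simp
  also have "\<dots> = (\<integral>\<^sup>+ g. \<integral>\<^sup>+ t. indicator ?Z (g(i := t)) \<partial>lborel \<partial>?M I)"
    using meas insert.hyps by (intro product_nn_integral_insert) auto
  also have "\<dots> = (\<integral>\<^sup>+ g. 0 \<partial>?M I)"
  proof (rule nn_integral_cong_AE)
    show "AE g in ?M I. (\<integral>\<^sup>+ t. indicator ?Z (g(i := t)) \<partial>lborel) = 0"
      using ae AE_space by eventually_elim (rule inner)
  qed
  finally show ?case using meas by (auto intro: null_setsI)
qed

text \<open>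
  The numerator and the denominator are one pair of polynomials for the whole of \<open>U\<close>: this is
  what lets a single point of \<open>U\<close> with a nonzero value control the zero set on all of \<open>U\<close>.
\<close>

definition rational_on :: "'i set \<Rightarrow> ('i \<Rightarrow> real) set \<Rightarrow> (('i \<Rightarrow> real) \<Rightarrow> real) \<Rightarrow> bool" where
  "rational_on I U f \<longleftrightarrow>
     (\<exists>p s. poly_fun I p \<and> poly_fun I s \<and> (\<forall>x\<in>U. s x \<noteq> 0 \<and> f x = p x / s x))"

lemma rational_onE:
  assumes "rational_on I U f"
  obtains p s where "poly_fun I p" "poly_fun I s" "\<And>x. x \<in> U \<Longrightarrow> s x \<noteq> 0"
    "\<And>x. x \<in> U \<Longrightarrow> f x = p x / s x"
  using assms unfolding rational_on_def by blast

lemma rational_on_cong: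
  "rational_on I U f \<Longrightarrow> (\<And>x. x \<in> U \<Longrightarrow> g x = f x) \<Longrightarrow> rational_on I U g"
  unfolding rational_on_def by force

lemma rational_on_subset: "rational_on I U f \<Longrightarrow> V \<subseteq> U \<Longrightarrow> rational_on I V f"
  unfolding rational_on_def by blast

lemma rational_on_poly: "poly_fun I p \<Longrightarrow> rational_on I U p"
  unfolding rational_on_def by (intro exI[of _ p] exI[of _ "\<lambda>_. 1"]) (auto intro: poly_fun.intros)

lemma rational_on_const: "rational_on I U (\<lambda>_. c)"
  by (intro rational_on_poly poly_fun.const)

lemma rational_on_add:
  assumes "rational_on I U f" "rational_on I U g" shows "rational_on I U (\<lambda>x. f x + g x)"
proof -
  obtain p s where 1: "poly_fun I p" "poly_fun I s" "\<And>x. x \<in> U \<Longrightarrow> s x \<noteq> 0"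
    "\<And>x. x \<in> U \<Longrightarrow> f x = p x / s x" using rational_onE[OF assms(1)] by blast
  obtain p' s' where 2: "poly_fun I p'" "poly_fun I s'" "\<And>x. x \<in> U \<Longrightarrow> s' x \<noteq> 0"
    "\<And>x. x \<in> U \<Longrightarrow> g x = p' x / s' x" using rational_onE[OF assms(2)] by blast
  show ?thesis unfolding rational_on_def
    by (intro exI[of _ "\<lambda>x. p x * s' x + p' x * s x"] exI[of _ "\<lambda>x. s x * s' x"])
      (auto intro!: poly_fun.intros simp: 1 2 add_frac_eq)
qed

lemma rational_on_mult:
  assumes "rational_on I U f" "rational_on I U g" shows "rational_on I U (\<lambda>x. f x * g x)"
proof -
  obtain p s where 1: "poly_fun I p" "poly_fun I s" "\<And>x. x \<in> U \<Longrightarrow> s x \<noteq> 0"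
    "\<And>x. x \<in> U \<Longrightarrow> f x = p x / s x" using rational_onE[OF assms(1)] by blast
  obtain p' s' where 2: "poly_fun I p'" "poly_fun I s'" "\<And>x. x \<in> U \<Longrightarrow> s' x \<noteq> 0"
    "\<And>x. x \<in> U \<Longrightarrow> g x = p' x / s' x" using rational_onE[OF assms(2)] by blast
  show ?thesis unfolding rational_on_def
    by (intro exI[of _ "\<lambda>x. p x * p' x"] exI[of _ "\<lambda>x. s x * s' x"])
      (auto intro!: poly_fun.intros simp: 1 2)
qed

lemma rational_on_diff:
  assumes "rational_on I U f" "rational_on I U g" shows "rational_on I U (\<lambda>x. f x - g x)"
  using rational_on_add[OF assms(1) rational_on_mult[OF rational_on_const[of I U "-1"] assms(2)]]
  by simp

lemma rational_on_divide:
  assumes "rational_on I U f" "rational_on I U g" "\<And>x. x \<in> U \<Longrightarrow> g x \<noteq> 0"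
  shows "rational_on I U (\<lambda>x. f x / g x)"
proof -
  obtain p s where 1: "poly_fun I p" "poly_fun I s" "\<And>x. x \<in> U \<Longrightarrow> s x \<noteq> 0"
    "\<And>x. x \<in> U \<Longrightarrow> f x = p x / s x" using rational_onE[OF assms(1)] by blast
  obtain p' s' where 2: "poly_fun I p'" "poly_fun I s'" "\<And>x. x \<in> U \<Longrightarrow> s' x \<noteq> 0"
    "\<And>x. x \<in> U \<Longrightarrow> g x = p' x / s' x" using rational_onE[OF assms(2)] by blast
  have 3: "p' x \<noteq> 0" if "x \<in> U" for x using 2(3,4)[OF that] assms(3)[OF that] by auto
  show ?thesis unfolding rational_on_def
    by (intro exI[of _ "\<lambda>x. p x * s' x"] exI[of _ "\<lambda>x. s x * p' x"])
      (auto intro!: poly_fun.intros simp: 1 2 3)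
qed

lemma rational_on_sum:
  "finite A \<Longrightarrow> (\<And>a. a \<in> A \<Longrightarrow> rational_on I U (f a)) \<Longrightarrow> rational_on I U (\<lambda>x. \<Sum>a\<in>A. f a x)"
  by (induction A rule: finite_induct) (auto intro: rational_on_const rational_on_add)

lemma rational_on_prod:
  "finite A \<Longrightarrow> (\<And>a. a \<in> A \<Longrightarrow> rational_on I U (f a)) \<Longrightarrow> rational_on I U (\<lambda>x. \<Prod>a\<in>A. f a x)"
  by (induction A rule: finite_induct) (auto intro: rational_on_const rational_on_mult)

lemma rational_on_power: "rational_on I U f \<Longrightarrow> rational_on I U (\<lambda>x. f x ^ m)"
  by (induction m) (auto intro: rational_on_const rational_on_mult)

lemma rational_zeros_null:
  assumes "finite I" and U: "U \<subseteq> I \<rightarrow>\<^sub>E UNIV" and "rational_on I U f" and x0: "x\<^sub>0 \<in> U" "f x\<^sub>0 \<noteq> 0"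
  shows "{x \<in> U. f x = 0} \<in> null_sets (completion (\<Pi>\<^sub>M i \<in> I. (lborel :: real measure)))"
proof -
  obtain p s where 1: "poly_fun I p" "poly_fun I s" "\<And>x. x \<in> U \<Longrightarrow> s x \<noteq> 0"
    "\<And>x. x \<in> U \<Longrightarrow> f x = p x / s x" using rational_onE[OF assms(3)] by blast
  have "p x\<^sub>0 \<noteq> 0" using x0 1(4) by fastforce
  then have "{x \<in> I \<rightarrow>\<^sub>E UNIV. p x = 0} \<in> null_sets (\<Pi>\<^sub>M i \<in> I. (lborel :: real measure))"
    using assms(1) 1(1) x0(1) U by (intro poly_fun_zeros_null[where f\<^sub>0 = x\<^sub>0]) auto
  moreover have "{x \<in> U. f x = 0} \<subseteq> {x \<in> I \<rightarrow>\<^sub>E UNIV. p x = 0}"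
  proof (intro subsetI CollectI conjI)
    fix x assume x: "x \<in> {x \<in> U. f x = 0}"
    then show "x \<in> I \<rightarrow>\<^sub>E UNIV" using U by blast
    show "p x = 0" using x 1(3)[of x] 1(4)[of x] by simp
  qed
  ultimately show ?thesis by (blast intro: null_sets_completion_subset[OF _ null_sets_completionI])
qed

section \<open>Rational vectors and matrices\<close>

definition rational_vec :: "'i set \<Rightarrow> ('i \<Rightarrow> real) set \<Rightarrow> nat \<Rightarrow> (('i \<Rightarrow> real) \<Rightarrow> real vec) \<Rightarrow> bool" where
  "rational_vec I U m v \<longleftrightarrow>
     (\<forall>x\<in>U. v x \<in> carrier_vec m) \<and> (\<forall>i<m. rational_on I U (\<lambda>x. v x $ i))"

definition rational_mat ::
  "'i set \<Rightarrow> ('i \<Rightarrow> real) set \<Rightarrow> nat \<Rightarrow> nat \<Rightarrow> (('i \<Rightarrow> real) \<Rightarrow> real mat) \<Rightarrow> bool" where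
  "rational_mat I U m l A \<longleftrightarrow>
     (\<forall>x\<in>U. A x \<in> carrier_mat m l) \<and> (\<forall>i<m. \<forall>j<l. rational_on I U (\<lambda>x. A x $$ (i, j)))"

lemma rational_vecI:
  assumes "\<And>x. x \<in> U \<Longrightarrow> v x \<in> carrier_vec m"
    and "\<And>i. i < m \<Longrightarrow> rational_on I U (\<lambda>x. v x $ i)"
  shows "rational_vec I U m v"
  using assms unfolding rational_vec_def by blast

lemma rational_vecD:
  assumes "rational_vec I U m v"
  shows "x \<in> U \<Longrightarrow> v x \<in> carrier_vec m" "x \<in> U \<Longrightarrow> dim_vec (v x) = m"
    "i < m \<Longrightarrow> rational_on I U (\<lambda>x. v x $ i)"
  using assms unfolding rational_vec_def by auto

lemma rational_matI:
  assumes "\<And>x. x \<in> U \<Longrightarrow> A x \<in> carrier_mat m l"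
    and "\<And>i j. i < m \<Longrightarrow> j < l \<Longrightarrow> rational_on I U (\<lambda>x. A x $$ (i, j))"
  shows "rational_mat I U m l A"
  using assms unfolding rational_mat_def by blast

lemma rational_matD:
  assumes "rational_mat I U m l A"
  shows "x \<in> U \<Longrightarrow> A x \<in> carrier_mat m l"
    "x \<in> U \<Longrightarrow> dim_row (A x) = m" "x \<in> U \<Longrightarrow> dim_col (A x) = l"
    "i < m \<Longrightarrow> j < l \<Longrightarrow> rational_on I U (\<lambda>x. A x $$ (i, j))"
  using assms unfolding rational_mat_def by auto

lemma rational_vec_subset: "rational_vec I U m v \<Longrightarrow> V \<subseteq> U \<Longrightarrow> rational_vec I V m v"
  unfolding rational_vec_def by (meson rational_on_subset subsetD)

lemma rational_mat_subset: "rational_mat I U m l A \<Longrightarrow> V \<subseteq> U \<Longrightarrow> rational_mat I V m l A"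
  unfolding rational_mat_def by (meson rational_on_subset subsetD)

lemma rational_vec_const: "v \<in> carrier_vec m \<Longrightarrow> rational_vec I U m (\<lambda>_. v)"
  by (auto intro: rational_vecI rational_on_const)

lemma rational_mat_const: "A \<in> carrier_mat m l \<Longrightarrow> rational_mat I U m l (\<lambda>_. A)"
  by (auto intro: rational_matI rational_on_const)

lemma rational_mat_transpose:
  assumes "rational_mat I U m l A"
  shows "rational_mat I U l m (\<lambda>x. transpose_mat (A x))"
proof (rule rational_matI)
  show "rational_on I U (\<lambda>x. transpose_mat (A x) $$ (i, j))" if "i < l" "j < m" for i j
    using rational_matD(4)[OF assms that(2,1)]
    by (rule rational_on_cong) (use that in \<open>simp add: rational_matD[OF assms]\<close>)
qed (simp add: rational_matD[OF assms])

lemma rational_scalar_prod: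
  assumes "rational_vec I U m v" "rational_vec I U m w"
  shows "rational_on I U (\<lambda>x. scalar_prod (v x) (w x))"
proof (rule rational_on_cong)
  show "rational_on I U (\<lambda>x. \<Sum>i\<in>{0..<m}. v x $ i * w x $ i)"
    by (intro rational_on_sum rational_on_mult)
      (simp_all add: rational_vecD[OF assms(1)] rational_vecD[OF assms(2)])
  show "scalar_prod (v x) (w x) = (\<Sum>i\<in>{0..<m}. v x $ i * w x $ i)" if "x \<in> U" for x
    using that by (simp add: scalar_prod_def rational_vecD[OF assms(2)])
qed

lemma rational_mat_row:
  assumes "rational_mat I U m l A" and i: "i < m"
  shows "rational_vec I U l (\<lambda>x. row (A x) i)"
proof (rule rational_vecI)
  show "rational_on I U (\<lambda>x. row (A x) i $ j)" if "j < l" for j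
    using rational_matD(4)[OF assms that]
    by (rule rational_on_cong) (use that i in \<open>simp add: rational_matD[OF assms(1)]\<close>)
qed (simp add: rational_matD[OF assms(1)] carrier_vecI)

lemma rational_mat_col:
  assumes "rational_mat I U m l A" and j: "j < l"
  shows "rational_vec I U m (\<lambda>x. col (A x) j)"
proof (rule rational_vecI)
  show "rational_on I U (\<lambda>x. col (A x) j $ i)" if "i < m" for i
    using rational_matD(4)[OF assms(1) that j]
    by (rule rational_on_cong) (use that j in \<open>simp add: rational_matD[OF assms(1)]\<close>)
qed (simp add: rational_matD[OF assms(1)] carrier_vecI)

lemma rational_mat_mult:
  assumes A: "rational_mat I U m l A" and B: "rational_mat I U l h B"
  shows "rational_mat I U m h (\<lambda>x. A x * B x)"
proof (rule rational_matI)
  show "rational_on I U (\<lambda>x. (A x * B x) $$ (i, j))" if "i < m" "j < h" for i j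
    using rational_scalar_prod[OF rational_mat_row[OF A that(1)] rational_mat_col[OF B that(2)]]
    by (rule rational_on_cong) (use that in \<open>simp add: rational_matD[OF A] rational_matD[OF B]\<close>)
qed (blast intro: mult_carrier_mat rational_matD(1)[OF A] rational_matD(1)[OF B])

lemma rational_mat_vec:
  assumes A: "rational_mat I U m l A" and v: "rational_vec I U l v"
  shows "rational_vec I U m (\<lambda>x. A x *\<^sub>v v x)"
proof (rule rational_vecI)
  show "rational_on I U (\<lambda>x. (A x *\<^sub>v v x) $ i)" if "i < m" for i
    using rational_scalar_prod[OF rational_mat_row[OF A that] v]
    by (rule rational_on_cong) (use that in \<open>simp add: rational_matD[OF A]\<close>)
qed (blast intro: mult_mat_vec_carrier rational_matD(1)[OF A] rational_vecD(1)[OF v])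

lemma rational_vec_diff:
  assumes v: "rational_vec I U m v" and w: "rational_vec I U m w"
  shows "rational_vec I U m (\<lambda>x. v x - w x)"
proof (rule rational_vecI)
  show "rational_on I U (\<lambda>x. (v x - w x) $ i)" if "i < m" for i
    using rational_on_diff[OF rational_vecD(3)[OF v that] rational_vecD(3)[OF w that]]
    by (rule rational_on_cong) (use that in \<open>simp add: rational_vecD[OF w]\<close>)
qed (blast intro: minus_carrier_vec rational_vecD(1)[OF v] rational_vecD(1)[OF w])

lemma rational_mat_smult:
  assumes c: "rational_on I U c" and A: "rational_mat I U m l A"
  shows "rational_mat I U m l (\<lambda>x. c x \<cdot>\<^sub>m A x)"
proof (rule rational_matI)
  show "rational_on I U (\<lambda>x. (c x \<cdot>\<^sub>m A x) $$ (i, j))" if "i < m" "j < l" for i j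
    using rational_on_mult[OF c rational_matD(4)[OF A that]]
    by (rule rational_on_cong) (use that in \<open>simp add: rational_matD[OF A]\<close>)
qed (use A in \<open>auto dest: rational_matD(1)\<close>)

lemma rational_det:
  assumes A: "rational_mat I U m m A"
  shows "rational_on I U (\<lambda>x. det (A x))"
proof (rule rational_on_cong)
  show "rational_on I U (\<lambda>x. \<Sum>p | p permutes {0..<m}. signof p * (\<Prod>i = 0..<m. A x $$ (i, p i)))"
  proof (intro rational_on_sum rational_on_mult rational_on_prod rational_on_const)
    fix p i assume "p \<in> {p. p permutes {0..<m}}" "i \<in> {0..<m}"
    then show "rational_on I U (\<lambda>x. A x $$ (i, p i))"
      using permutes_in_image[of p "{0..<m}" i] by (intro rational_matD(4)[OF A]) auto
  qed (auto simp: finite_permutations)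
qed (rule det_def'[OF rational_matD(1)[OF A]])

text \<open>
  Cramer's rule, which makes the entries of an inverse quotients of determinants.
\<close>

lemma minv_eq_adj:
  assumes A: "A \<in> carrier_mat m m" and nz: "det A \<noteq> 0"
  shows "minv A = (1 / det A) \<cdot>\<^sub>m adj_mat A"
proof -
  have c: "adj_mat A \<in> carrier_mat m m" "minv A \<in> carrier_mat m m"
    using adj_mat(1)[OF A] minv(1)[OF A nz] .
  have "adj_mat A = (minv A * A) * adj_mat A" using minv(3)[OF A nz] c by simp
  also have "\<dots> = minv A * (A * adj_mat A)" using A c by (intro assoc_mult_mat) auto
  also have "\<dots> = det A \<cdot>\<^sub>m minv A" unfolding adj_mat(2)[OF A]
    using c by (metis mult_smult_distrib one_carrier_mat right_mult_one_mat)
  finally show ?thesis using c nz by (intro eq_matI) auto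
qed

lemma rational_minv:
  assumes A: "rational_mat I U m m A" and nz: "\<And>x. x \<in> U \<Longrightarrow> det (A x) \<noteq> 0"
  shows "rational_mat I U m m (\<lambda>x. minv (A x))"
proof (rule rational_matI)
  show "minv (A x) \<in> carrier_mat m m" if "x \<in> U" for x
    using minv(1)[OF rational_matD(1)[OF A that] nz[OF that]] .
  fix i j assume ij: "i < m" "j < m"
  have del: "rational_mat I U (m - 1) (m - 1) (\<lambda>x. mat_delete (A x) j i)"
  proof (rule rational_matI)
    fix i' j' assume lt: "i' < m - 1" "j' < m - 1"
    then have "rational_on I U (\<lambda>x. A x $$ (if i' < j then i' else Suc i', if j' < i then j' else Suc j'))"
      by (intro rational_matD(4)[OF A]) auto
    then show "rational_on I U (\<lambda>x. mat_delete (A x) j i $$ (i', j'))"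
      by (rule rational_on_cong) (use lt in \<open>simp add: mat_delete_def rational_matD[OF A]\<close>)
  qed (simp add: mat_delete_def rational_matD[OF A])
  have "rational_on I U (\<lambda>x. (1 / det (A x)) * ((-1) ^ (j + i) * det (mat_delete (A x) j i)))"
    by (intro rational_on_mult rational_on_divide rational_on_const rational_det[OF A] nz
        rational_det[OF del])
  then show "rational_on I U (\<lambda>x. minv (A x) $$ (i, j))"
  proof (rule rational_on_cong)
    fix x assume x: "x \<in> U"
    show "minv (A x) $$ (i, j) = 1 / det (A x) * ((- 1) ^ (j + i) * det (mat_delete (A x) j i))"
      using minv_eq_adj[OF rational_matD(1)[OF A x] nz[OF x]] ij
      by (simp add: adj_mat_def cofactor_def rational_matD(1-3)[OF A x])
  qed
qed

section \<open>Full rank and positive quadratic forms\<close>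

lemma mult_unit_vec:
  fixes A :: "real mat"
  assumes "A \<in> carrier_mat n k" "i < k"
  shows "A *\<^sub>v unit_vec k i = col A i"
  using assms by (intro eq_vecI) auto

lemma mult_mat_zero_vec:
  fixes A :: "real mat"
  assumes "A \<in> carrier_mat n k"
  shows "A *\<^sub>v 0\<^sub>v k = 0\<^sub>v n"
  using assms by (intro eq_vecI) auto

text \<open>
  The rank counts a maximal independent subset of the \<^emph>\<open>set\<close> of columns, so it equals the number of
  columns only if these are distinct; a repeated column already yields a kernel vector.
\<close>

lemma rank_eq_dim_col_iff:
  fixes A :: "real mat"
  assumes A: "A \<in> carrier_mat n k"
  shows "vec_space.rank n A = k \<longleftrightarrow> (\<forall>v \<in> carrier_vec k. A *\<^sub>v v = 0\<^sub>v n \<longrightarrow> v = 0\<^sub>v k)"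
proof -
  interpret vec_space "TYPE(real)" n .
  show ?thesis
  proof
    assume rk: "rank A = k"
    have dist: "distinct (cols A)"
    proof (rule ccontr)
      assume nd: "\<not> distinct (cols A)"
      obtain S where S: "maximal S (\<lambda>T. T \<subseteq> set (cols A) \<and> lin_indpt T)"
        using maximal_exists[of "(\<lambda>T. T \<subseteq> set (cols A) \<and> lin_indpt T)" "card (set (cols A))" "{}"]
        by (meson List.finite_set card_mono empty_iff empty_subsetI finite_lin_indpt2 rev_finite_subset)
      then have "card S \<le> card (set (cols A))" by (simp add: card_mono maximal_def)
      also have "\<dots> < length (cols A)"
        using nd card_distinct card_length le_neq_implies_less by blast
      finally show False using rank_card_indpt[OF A S] rk A by simp
    qed
    show "\<forall>v \<in> carrier_vec k. A *\<^sub>v v = 0\<^sub>v n \<longrightarrow> v = 0\<^sub>v k"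
      using lin_depI[OF A _ _ _ dist] full_rank_lin_indpt[OF A rk dist] by blast
  next
    assume inj: "\<forall>v \<in> carrier_vec k. A *\<^sub>v v = 0\<^sub>v n \<longrightarrow> v = 0\<^sub>v k"
    have dist: "distinct (cols A)"
      unfolding distinct_conv_nth
    proof (intro allI impI notI)
      fix i j assume ij: "i < length (cols A)" "j < length (cols A)" "i \<noteq> j" "cols A ! i = cols A ! j"
      then have ij': "i < k" "j < k" "col A i = col A j" using A by auto
      let ?v = "unit_vec k i - unit_vec k j :: real vec"
      have "A *\<^sub>v ?v = A *\<^sub>v unit_vec k i - A *\<^sub>v unit_vec k j"
        using A by (intro mult_minus_distrib_mat_vec) auto
      also have "\<dots> = 0\<^sub>v n" using A ij' by (simp add: mult_unit_vec)
      finally have "?v = 0\<^sub>v k" using inj by simp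
      then have "?v $ i = 0" using ij' by simp
      then show False using ij' ij(3) by simp
    qed
    show "rank A = k"
      using lin_depE[OF A _ dist] inj lin_indpt_full_rank[OF A dist] by metis
  qed
qed

lemma rank_eq_dim_row_surj:
  fixes A :: "real mat"
  assumes A: "A \<in> carrier_mat q k" and rk: "vec_space.rank q A = q" and y: "y \<in> carrier_vec q"
  shows "\<exists>x \<in> carrier_vec k. A *\<^sub>v x = y"
proof -
  interpret vec_space "TYPE(real)" q .
  have fin: "finite (set (cols A))" and sub: "set (cols A) \<subseteq> carrier_vec q"
    using cols_dim[of A] A by auto
  obtain S where S: "maximal S (\<lambda>T. T \<subseteq> set (cols A) \<and> lin_indpt T)"
    using maximal_exists[of "(\<lambda>T. T \<subseteq> set (cols A) \<and> lin_indpt T)" "card (set (cols A))" "{}"]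
    by (meson List.finite_set card_mono empty_iff empty_subsetI finite_lin_indpt2 rev_finite_subset)
  then have SA: "S \<subseteq> set (cols A)" and li: "lin_indpt S" by (auto simp: maximal_def)
  have "card S = q" using rank_card_indpt[OF A S] rk by simp
  then have "basis S"
    using dim_li_is_basis[OF fin_dim, of S] SA sub fin li finite_subset[OF SA fin] by (auto simp: dim_is_n)
  then have "span S = carrier_vec q" by (auto simp: basis_def)
  then have "col_space A = carrier_vec q"
    using span_is_monotone[OF SA] span_closed sub unfolding col_space_def by blast
  then show ?thesis using y A unfolding col_space_eq[OF A] by auto
qed

text \<open>
  The variant of positive definiteness without symmetry. It implies nonsingularity and passes to
  inverses and congruences, from which the nonsingularity of all estimated matrices follows.
\<close>

definition pos_quadratic :: "nat \<Rightarrow> real mat \<Rightarrow> bool" where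
  "pos_quadratic n A \<longleftrightarrow> A \<in> carrier_mat n n \<and>
     (\<forall>x \<in> carrier_vec n. x \<noteq> 0\<^sub>v n \<longrightarrow> x \<bullet> (A *\<^sub>v x) > 0)"

lemma pos_quadratic_det:
  assumes "pos_quadratic n A" shows "det A \<noteq> 0"
proof
  assume "det A = 0"
  then obtain v where "v \<in> carrier_vec n" "v \<noteq> 0\<^sub>v n" "A *\<^sub>v v = 0\<^sub>v n"
    using det_0_iff_vec_prod_zero_field assms unfolding pos_quadratic_def by blast
  then show False using assms unfolding pos_quadratic_def by fastforce
qed

lemma pos_quadratic_minv:
  assumes pq: "pos_quadratic n A" shows "pos_quadratic n (minv A)"
proof -
  have A: "A \<in> carrier_mat n n" using pq by (simp add: pos_quadratic_def)
  note M = minv[OF A pos_quadratic_det[OF pq]]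
  have "x \<bullet> (minv A *\<^sub>v x) > 0" if x: "x \<in> carrier_vec n" "x \<noteq> 0\<^sub>v n" for x
  proof -
    let ?w = "minv A *\<^sub>v x"
    have w: "?w \<in> carrier_vec n" using M(1) x by auto
    have Aw: "A *\<^sub>v ?w = x" using M x A by (metis assoc_mult_mat_vec one_mult_mat_vec)
    then have "?w \<noteq> 0\<^sub>v n" using x mult_mat_zero_vec[OF A] by metis
    then have "?w \<bullet> (A *\<^sub>v ?w) > 0" using pq w by (simp add: pos_quadratic_def)
    then show ?thesis unfolding Aw using comm_scalar_prod[OF w x(1)] by simp
  qed
  then show ?thesis using M(1) by (simp add: pos_quadratic_def)
qed

lemma pos_quadratic_congruence:
  assumes pq: "pos_quadratic n A" and B: "B \<in> carrier_mat n k"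
    and inj: "\<forall>v \<in> carrier_vec k. B *\<^sub>v v = 0\<^sub>v n \<longrightarrow> v = 0\<^sub>v k"
  shows "pos_quadratic k (transpose_mat B * A * B)"
proof -
  have A: "A \<in> carrier_mat n n" using pq by (simp add: pos_quadratic_def)
  have "v \<bullet> ((transpose_mat B * A * B) *\<^sub>v v) > 0" if v: "v \<in> carrier_vec k" "v \<noteq> 0\<^sub>v k" for v
  proof -
    let ?w = "B *\<^sub>v v"
    have w: "?w \<in> carrier_vec n" using B v by auto
    have "(transpose_mat B * A * B) *\<^sub>v v = (transpose_mat B * A) *\<^sub>v ?w"
      using A B v by (intro assoc_mult_mat_vec) auto
    also have "\<dots> = transpose_mat B *\<^sub>v (A *\<^sub>v ?w)"
      using A B w by (intro assoc_mult_mat_vec) auto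
    finally have "v \<bullet> ((transpose_mat B * A * B) *\<^sub>v v) = (transpose_mat B *\<^sub>v (A *\<^sub>v ?w)) \<bullet> v"
      using A B v w by (metis comm_scalar_prod mult_mat_vec_carrier transpose_carrier_mat)
    also have "\<dots> = (A *\<^sub>v ?w) \<bullet> ?w"
      using A B v w by (intro transpose_vec_mult_scalar) auto
    also have "\<dots> = ?w \<bullet> (A *\<^sub>v ?w)" using A w by (intro comm_scalar_prod) auto
    also have "\<dots> > 0" using pq w inj v unfolding pos_quadratic_def by blast
    finally show ?thesis .
  qed
  then show ?thesis using A B by (simp add: pos_quadratic_def)
qed

lemma scalar_prod_self_pos:
  "v \<in> carrier_vec n \<Longrightarrow> v \<noteq> 0\<^sub>v n \<Longrightarrow> v \<bullet> v > (0 :: real)"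
  using conjugate_square_greater_0_vec[of v n] by simp

lemma pos_quadratic_one: "pos_quadratic n (1\<^sub>m n)"
  by (auto simp: pos_quadratic_def scalar_prod_self_pos)

lemma det_gram_nonzero_iff:
  fixes X :: "real mat"
  assumes X: "X \<in> carrier_mat n k"
  shows "det (transpose_mat X * X) \<noteq> 0 \<longleftrightarrow> (\<forall>v \<in> carrier_vec k. X *\<^sub>v v = 0\<^sub>v n \<longrightarrow> v = 0\<^sub>v k)"
proof
  assume nz: "det (transpose_mat X * X) \<noteq> 0"
  show "\<forall>v \<in> carrier_vec k. X *\<^sub>v v = 0\<^sub>v n \<longrightarrow> v = 0\<^sub>v k"
  proof (intro ballI impI)
    fix v assume v: "v \<in> carrier_vec k" "X *\<^sub>v v = 0\<^sub>v n"
    have "(transpose_mat X * X) *\<^sub>v v = transpose_mat X *\<^sub>v (X *\<^sub>v v)"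
      using X v by (intro assoc_mult_mat_vec) auto
    also have "\<dots> = 0\<^sub>v k" using X v by (auto intro!: eq_vecI)
    finally show "v = 0\<^sub>v k"
      using nz v X det_0_iff_vec_prod_zero_field[of "transpose_mat X * X" k] by auto
  qed
next
  assume "\<forall>v \<in> carrier_vec k. X *\<^sub>v v = 0\<^sub>v n \<longrightarrow> v = 0\<^sub>v k"
  then have "pos_quadratic k (transpose_mat X * 1\<^sub>m n * X)"
    using X pos_quadratic_congruence[OF pos_quadratic_one] by blast
  then show "det (transpose_mat X * X) \<noteq> 0" using X pos_quadratic_det by auto
qed

lemma transpose_minv_symmetric:
  assumes A: "A \<in> carrier_mat m m" and sym: "transpose_mat A = A" and nz: "det A \<noteq> 0"
  shows "transpose_mat (minv A) = minv A"
proof -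
  note M = minv[OF A nz]
  have t: "transpose_mat (minv A) \<in> carrier_mat m m" using M(1) by simp
  have "transpose_mat (minv A) * A = 1\<^sub>m m"
    using transpose_mult[OF A M(1)] M(2) sym by simp
  then have "minv A = (transpose_mat (minv A) * A) * minv A" using M(1) by simp
  also have "\<dots> = transpose_mat (minv A) * (A * minv A)" using A M(1) t by (intro assoc_mult_mat) auto
  also have "\<dots> = transpose_mat (minv A)" using M(2) t by simp
  finally show ?thesis by simp
qed

section \<open>The AR(1) correlation matrix\<close>

text \<open>
  A stationary AR(1) process is a moving average of its innovations. The rows of \<open>ar1_factor\<close> are the
  moving average weights when the process is started in its first observation; the innovations are
  uncorrelated with variance \<open>1\<close> at the start and \<open>1 - \<rho>\<^sup>2\<close> afterwards.
\<close>

definition ar1_factor :: "nat \<Rightarrow> real \<Rightarrow> real mat" where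
  "ar1_factor n \<rho> = mat n n (\<lambda>(i, j). if j \<le> i then \<rho> ^ (i - j) else 0)"

definition ar1_innovation_cov :: "nat \<Rightarrow> real \<Rightarrow> real mat" where
  "ar1_innovation_cov n \<rho> = mat n n (\<lambda>(i, j). if i = j then (if i = 0 then 1 else 1 - \<rho>\<^sup>2) else 0)"

lemma ar1_carrier:
  "ar1_factor n \<rho> \<in> carrier_mat n n" "ar1_innovation_cov n \<rho> \<in> carrier_mat n n"
  "Lam n \<rho> \<in> carrier_mat n n"
  by (simp_all add: ar1_factor_def ar1_innovation_cov_def Lam_def)

lemma ar1_autocovariance_sum:
  fixes \<rho> :: real
  shows "(\<Sum>m\<le>i. \<rho> ^ (i - m) * (if m = 0 then 1 else 1 - \<rho>\<^sup>2) * \<rho> ^ (i + t - m)) = \<rho> ^ t"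
proof (induction i)
  case (Suc i)
  have "(\<Sum>m\<le>i. \<rho> ^ (Suc i - m) * (if m = 0 then 1 else 1 - \<rho>\<^sup>2) * \<rho> ^ (Suc i + t - m))
      = (\<Sum>m\<le>i. \<rho>\<^sup>2 * (\<rho> ^ (i - m) * (if m = 0 then 1 else 1 - \<rho>\<^sup>2) * \<rho> ^ (i + t - m)))"
    by (intro sum.cong) (auto simp: Suc_diff_le power2_eq_square)
  also have "\<dots> = \<rho>\<^sup>2 * \<rho> ^ t" using Suc.IH by (simp add: sum_distrib_left[symmetric])
  finally show ?case by (simp add: algebra_simps)
qed simp

lemma ar1_entry:
  fixes \<rho> :: real
  assumes "i < n" "j < n"
  shows "(\<Sum>m<n. (if m \<le> i then \<rho> ^ (i - m) else 0) * (if m = 0 then 1 else 1 - \<rho>\<^sup>2) *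
      (if m \<le> j then \<rho> ^ (j - m) else 0)) = \<rho> ^ nat \<bar>int i - int j\<bar>"
proof -
  have le: "(\<Sum>m<n. (if m \<le> i then \<rho> ^ (i - m) else 0) * (if m = 0 then 1 else 1 - \<rho>\<^sup>2) *
      (if m \<le> j then \<rho> ^ (j - m) else 0)) = \<rho> ^ (j - i)" if "i \<le> j" "j < n" for i j
  proof -
    have "(\<Sum>m<n. (if m \<le> i then \<rho> ^ (i - m) else 0) * (if m = 0 then 1 else 1 - \<rho>\<^sup>2) *
        (if m \<le> j then \<rho> ^ (j - m) else 0))
      = (\<Sum>m\<le>i. \<rho> ^ (i - m) * (if m = 0 then 1 else 1 - \<rho>\<^sup>2) * \<rho> ^ (i + (j - i) - m))"
      using that by (intro sum.mono_neutral_cong_right) auto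
    also have "\<dots> = \<rho> ^ (j - i)" by (rule ar1_autocovariance_sum)
    finally show ?thesis .
  qed
  show ?thesis
  proof (cases "i \<le> j")
    case True
    then show ?thesis using le[OF True assms(2)] by (simp add: nat_diff_distrib)
  next
    case False
    have "nat \<bar>int i - int j\<bar> = i - j" using False by simp
    moreover have "(\<Sum>m<n. (if m \<le> i then \<rho> ^ (i - m) else 0) * (if m = 0 then 1 else 1 - \<rho>\<^sup>2) *
      (if m \<le> j then \<rho> ^ (j - m) else 0)) =
      (\<Sum>m<n. (if m \<le> j then \<rho> ^ (j - m) else 0) * (if m = 0 then 1 else 1 - \<rho>\<^sup>2) *
      (if m \<le> i then \<rho> ^ (i - m) else 0))" by (intro sum.cong) auto
    ultimately show ?thesis using le[of j i] False assms by simp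
  qed
qed

text \<open>
  Since the factor is lower triangular with unit diagonal, the factorization yields both the
  determinant of \<open>Lam\<close> for every \<open>\<rho>\<close> and its positivity for \<open>\<bar>\<rho>\<bar> < 1\<close>.
\<close>

lemma Lam_factorization:
  "Lam n \<rho> = ar1_factor n \<rho> * ar1_innovation_cov n \<rho> * transpose_mat (ar1_factor n \<rho>)"
proof (rule eq_matI)
  let ?B = "ar1_factor n \<rho>" and ?D = "ar1_innovation_cov n \<rho>"
  fix i j assume "i < dim_row (?B * ?D * transpose_mat ?B)" "j < dim_col (?B * ?D * transpose_mat ?B)"
  then have ij: "i < n" "j < n" by (simp_all add: ar1_factor_def)
  have B: "?B $$ (a, b) = (if b \<le> a then \<rho> ^ (a - b) else 0)" if "a < n" "b < n" for a b
    using that by (simp add: ar1_factor_def)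
  have BD: "(?B * ?D) $$ (i, m) = ?B $$ (i, m) * (if m = 0 then 1 else 1 - \<rho>\<^sup>2)" if "m < n" for m
  proof -
    have "(?B * ?D) $$ (i, m) = (\<Sum>l\<in>{0..<n}. ?B $$ (i, l) * ?D $$ (l, m))"
      using that ij by (simp add: ar1_factor_def ar1_innovation_cov_def scalar_prod_def)
    also have "\<dots> = (\<Sum>l\<in>{0..<n}. if l = m then ?B $$ (i, l) * (if m = 0 then 1 else 1 - \<rho>\<^sup>2) else 0)"
      using that by (intro sum.cong) (auto simp: ar1_innovation_cov_def)
    finally show ?thesis using that by simp
  qed
  have BT: "(P * transpose_mat ?B) $$ (i, j) = (\<Sum>m\<in>{0..<n}. P $$ (i, m) * ?B $$ (j, m))"
    if "P \<in> carrier_mat n n" for P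
    using that ij ar1_carrier[of n \<rho>] by (simp add: scalar_prod_def)
  have "(?B * ?D * transpose_mat ?B) $$ (i, j) = (\<Sum>m\<in>{0..<n}. (?B * ?D) $$ (i, m) * ?B $$ (j, m))"
    using ar1_carrier[of n \<rho>] by (intro BT) auto
  also have "\<dots> = (\<Sum>m<n. (if m \<le> i then \<rho> ^ (i - m) else 0) * (if m = 0 then 1 else 1 - \<rho>\<^sup>2) *
      (if m \<le> j then \<rho> ^ (j - m) else 0))"
    using ij by (intro sum.cong) (simp_all add: BD B atLeast0LessThan)
  also have "\<dots> = Lam n \<rho> $$ (i, j)" unfolding ar1_entry[OF ij] using ij by (simp add: Lam_def)
  finally show "Lam n \<rho> $$ (i, j) = (?B * ?D * transpose_mat ?B) $$ (i, j)" by simp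
qed (simp_all add: ar1_factor_def Lam_def)

lemma det_ar1_factor: "det (ar1_factor n \<rho>) = 1"
proof -
  have "det (ar1_factor n \<rho>) = prod_list (diag_mat (ar1_factor n \<rho>))"
    by (rule det_lower_triangular[OF _ ar1_carrier(1)]) (auto simp: ar1_factor_def)
  also have "\<dots> = 1" by (auto simp: prod_list_diag_prod ar1_factor_def)
  finally show ?thesis .
qed

lemma det_Lam: "det (Lam n \<rho>) = (\<Prod>i<n. if i = 0 then 1 else 1 - \<rho>\<^sup>2)"
proof -
  let ?B = "ar1_factor n \<rho>" and ?D = "ar1_innovation_cov n \<rho>"
  have "det ?D = prod_list (diag_mat ?D)"
    by (rule det_lower_triangular[OF _ ar1_carrier(2)]) (auto simp: ar1_innovation_cov_def)
  also have "\<dots> = (\<Prod>i<n. if i = 0 then 1 else 1 - \<rho>\<^sup>2)"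
    by (auto simp: prod_list_diag_prod ar1_innovation_cov_def atLeast0LessThan intro!: prod.cong)
  finally show ?thesis
    unfolding Lam_factorization using ar1_carrier[of n \<rho>]
    by (simp add: det_mult[of _ n] det_transpose det_ar1_factor)
qed

text \<open>
  The estimator \<open>rho_hat\<close> may leave \<open>(-1, 1)\<close> when the sum in its denominator omits an end point, so
  values with \<open>\<bar>\<rho>\<bar> > 1\<close> have to be included.
\<close>

lemma det_Lam_nonzero: "\<bar>\<rho>\<bar> \<noteq> 1 \<Longrightarrow> det (Lam n \<rho>) \<noteq> 0"
  by (auto simp: det_Lam power2_eq_1_iff abs_if split: if_splits)

lemma pos_quadratic_Lam:
  assumes "\<bar>\<rho>\<bar> < 1" shows "pos_quadratic n (Lam n \<rho>)"
proof -
  let ?B = "ar1_factor n \<rho>" and ?D = "ar1_innovation_cov n \<rho>"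
  have rho: "1 - \<rho>\<^sup>2 > 0" using assms by (simp add: abs_square_less_1)
  have "v \<bullet> (?D *\<^sub>v v) > 0" if v: "v \<in> carrier_vec n" "v \<noteq> 0\<^sub>v n" for v
  proof -
    define d where "d i = (if i = 0 then 1 else 1 - \<rho>\<^sup>2)" for i :: nat
    have d: "d i > 0" for i using rho by (simp add: d_def)
    have Dv: "(?D *\<^sub>v v) $ i = d i * v $ i" if i: "i < n" for i
    proof -
      have "(?D *\<^sub>v v) $ i = (\<Sum>l\<in>{0..<n}. ?D $$ (i, l) * v $ l)"
        using i v by (simp add: ar1_innovation_cov_def scalar_prod_def)
      also have "\<dots> = (\<Sum>l\<in>{0..<n}. if l = i then d l * v $ l else 0)"
        using i by (intro sum.cong) (auto simp: ar1_innovation_cov_def d_def)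
      finally show ?thesis using i by simp
    qed
    have "v \<bullet> (?D *\<^sub>v v) = (\<Sum>i\<in>{0..<n}. v $ i * (?D *\<^sub>v v) $ i)"
      by (simp add: scalar_prod_def ar1_innovation_cov_def)
    also have "\<dots> = (\<Sum>i\<in>{0..<n}. d i * (v $ i)\<^sup>2)"
      by (intro sum.cong) (auto simp: Dv power2_eq_square)
    also have "\<dots> > 0"
    proof -
      obtain i where "i < n" "v $ i \<noteq> 0" using v by (metis eq_vecI carrier_vecD index_zero_vec)
      then show ?thesis using d by (intro sum_pos2[of _ i]) (auto intro!: mult_nonneg_nonneg less_imp_le[OF d])
    qed
    finally show ?thesis .
  qed
  then have "pos_quadratic n ?D" by (simp add: pos_quadratic_def ar1_carrier)
  moreover have "\<forall>v \<in> carrier_vec n. transpose_mat ?B *\<^sub>v v = 0\<^sub>v n \<longrightarrow> v = 0\<^sub>v n"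
    using det_0_iff_vec_prod_zero_field[of "transpose_mat ?B" n] ar1_carrier(1)[of n \<rho>]
    by (auto simp: det_transpose[OF ar1_carrier(1)] det_ar1_factor)
  ultimately have "pos_quadratic n (transpose_mat (transpose_mat ?B) * ?D * transpose_mat ?B)"
    by (intro pos_quadratic_congruence) (simp_all only: transpose_carrier_mat ar1_carrier)
  then show ?thesis unfolding Lam_factorization transpose_transpose .
qed

section \<open>Invariance of the regression quantities\<close>

text \<open>
  The weight \<open>W\<close> is the identity for OLS and the inverse of the estimated correlation matrix for
  FGLS.
\<close>

lemma gls_coefficient_shift:
  fixes X W :: "real mat"
  assumes X: "X \<in> carrier_mat n k" and W: "W \<in> carrier_mat n n"
    and nz: "det (transpose_mat X * W * X) \<noteq> 0"
    and y: "y \<in> carrier_vec n" and b: "b \<in> carrier_vec k"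
  shows "minv (transpose_mat X * W * X) *\<^sub>v (transpose_mat X *\<^sub>v (W *\<^sub>v (y + X *\<^sub>v b)))
    = minv (transpose_mat X * W * X) *\<^sub>v (transpose_mat X *\<^sub>v (W *\<^sub>v y)) + b"
proof -
  let ?G = "transpose_mat X * W * X"
  have Xt: "transpose_mat X \<in> carrier_mat k n" using X by simp
  have G: "?G \<in> carrier_mat k k" using X W by simp
  note M = minv[OF G nz]
  have Xb: "X *\<^sub>v b \<in> carrier_vec n" using X b by auto
  have Wy: "W *\<^sub>v y \<in> carrier_vec n" "W *\<^sub>v (X *\<^sub>v b) \<in> carrier_vec n" using W y Xb by auto
  have XWy: "transpose_mat X *\<^sub>v (W *\<^sub>v y) \<in> carrier_vec k" using Xt Wy by auto
  have Gb: "?G *\<^sub>v b \<in> carrier_vec k" using G b by auto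
  have "?G *\<^sub>v b = (transpose_mat X * W) *\<^sub>v (X *\<^sub>v b)"
    using Xt W X b by (intro assoc_mult_mat_vec) auto
  also have "\<dots> = transpose_mat X *\<^sub>v (W *\<^sub>v (X *\<^sub>v b))"
    using Xt W Xb by (intro assoc_mult_mat_vec)
  finally have *: "transpose_mat X *\<^sub>v (W *\<^sub>v (X *\<^sub>v b)) = ?G *\<^sub>v b" by simp
  have "transpose_mat X *\<^sub>v (W *\<^sub>v (y + X *\<^sub>v b)) = transpose_mat X *\<^sub>v (W *\<^sub>v y) + ?G *\<^sub>v b"
    unfolding mult_add_distrib_mat_vec[OF W y Xb] mult_add_distrib_mat_vec[OF Xt Wy] * ..
  then have "minv ?G *\<^sub>v (transpose_mat X *\<^sub>v (W *\<^sub>v (y + X *\<^sub>v b)))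
      = minv ?G *\<^sub>v (transpose_mat X *\<^sub>v (W *\<^sub>v y)) + minv ?G *\<^sub>v (?G *\<^sub>v b)"
    using mult_add_distrib_mat_vec[OF M(1) XWy Gb] by simp
  also have "minv ?G *\<^sub>v (?G *\<^sub>v b) = b"
    using assoc_mult_mat_vec[OF M(1) G b] M(3) b by simp
  finally show ?thesis .
qed

lemma residual_shift:
  fixes X :: "real mat"
  assumes "X \<in> carrier_mat n k" "y \<in> carrier_vec n" "b \<in> carrier_vec k" "c \<in> carrier_vec k"
  shows "(y + X *\<^sub>v b) - X *\<^sub>v (c + b) = y - X *\<^sub>v c"
  unfolding mult_add_distrib_mat_vec[OF assms(1,4,3)]
  using assms by (intro eq_vecI) auto

locale linear_restriction =
  fixes n k q a\<^sub>1 a\<^sub>2 :: nat and R :: "real mat" and r :: "real vec"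
  assumes k_pos: "1 \<le> k" and k_less: "k < n"
    and R: "R \<in> carrier_mat q k" and rank_R: "vec_space.rank q R = q" and r: "r \<in> carrier_vec q"
    and a1: "a\<^sub>1 \<in> {1, 2}" and a2: "a\<^sub>2 \<in> {n - 1, n}" and a1_le: "a\<^sub>1 \<le> a\<^sub>2"
begin

definition full_rank :: "real mat \<Rightarrow> bool" where
  "full_rank X \<longleftrightarrow> X \<in> carrier_mat n k \<and> det (transpose_mat X * X) \<noteq> 0"

lemma full_rank_iff_XX0: "full_rank X \<longleftrightarrow> X \<in> XX0 n k"
proof (cases "X \<in> carrier_mat n k")
  case True
  then show ?thesis
    using rank_eq_dim_col_iff[OF True] det_gram_nonzero_iff[OF True]
    by (simp add: full_rank_def XX0_def)
qed (simp add: full_rank_def XX0_def)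

lemma full_rankD:
  assumes "full_rank X"
  shows "X \<in> carrier_mat n k" "transpose_mat X \<in> carrier_mat k n"
    "transpose_mat X * X \<in> carrier_mat k k" "det (transpose_mat X * X) \<noteq> 0"
    "minv (transpose_mat X * X) \<in> carrier_mat k k" "dim_row X = n" "dim_col X = k"
  using assms minv(1)[of "transpose_mat X * X" k] by (auto simp: full_rank_def)

lemma transpose_R_inj: "v \<in> carrier_vec q \<Longrightarrow> transpose_mat R *\<^sub>v v = 0\<^sub>v k \<Longrightarrow> v = 0\<^sub>v q"
proof (rule ccontr)
  assume v: "v \<in> carrier_vec q" "transpose_mat R *\<^sub>v v = 0\<^sub>v k" "v \<noteq> 0\<^sub>v q"
  obtain x where x: "x \<in> carrier_vec k" "R *\<^sub>v x = v"
    using rank_eq_dim_row_surj[OF R rank_R v(1)] by blast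
  have "v \<bullet> v = (transpose_mat R *\<^sub>v v) \<bullet> x"
    using transpose_vec_mult_scalar[OF R x(1) v(1)] x(2) by simp
  then show False using v x scalar_prod_self_pos[OF v(1,3)] by simp
qed

lemma restricted_coefficient_exists: obtains b where "b \<in> carrier_vec k" "R *\<^sub>v b = r"
  using rank_eq_dim_row_surj[OF R rank_R r] by blast

context
  fixes X assumes X: "full_rank X"
begin

lemma beta_hat_carrier: "y \<in> carrier_vec n \<Longrightarrow> beta_hat X y \<in> carrier_vec k"
  using full_rankD[OF X] by (auto simp: beta_hat_def)

lemma u_hat_carrier: "y \<in> carrier_vec n \<Longrightarrow> u_hat X y \<in> carrier_vec n"
  using full_rankD[OF X] beta_hat_carrier by (auto simp: u_hat_def)

lemma beta_hat_shift:
  assumes y: "y \<in> carrier_vec n" and b: "b \<in> carrier_vec k"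
  shows "beta_hat X (y + X *\<^sub>v b) = beta_hat X y + b"
proof -
  have "X *\<^sub>v b \<in> carrier_vec n" using full_rankD[OF X] b by auto
  then show ?thesis
    using gls_coefficient_shift[OF full_rankD(1)[OF X] one_carrier_mat _ y b] full_rankD[OF X] y b
    by (simp add: beta_hat_def)
qed

lemma u_hat_shift:
  assumes y: "y \<in> carrier_vec n" and b: "b \<in> carrier_vec k"
  shows "u_hat X (y + X *\<^sub>v b) = u_hat X y"
  unfolding u_hat_def beta_hat_shift[OF y b]
  using residual_shift[OF full_rankD(1)[OF X] y b beta_hat_carrier[OF y]] .

lemma beta_hat_orthogonal:
  assumes "transpose_mat X *\<^sub>v u = 0\<^sub>v k"
  shows "beta_hat X u = 0\<^sub>v k"
  unfolding beta_hat_def assms using mult_mat_zero_vec[OF full_rankD(5)[OF X]] .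

lemma u_hat_orthogonal:
  assumes u: "u \<in> carrier_vec n" and orth: "transpose_mat X *\<^sub>v u = 0\<^sub>v k"
  shows "u_hat X u = u"
  unfolding u_hat_def beta_hat_orthogonal[OF orth] mult_mat_zero_vec[OF full_rankD(1)[OF X]]
  using u by auto

lemma transpose_design_zero: "transpose_mat X *\<^sub>v 0\<^sub>v n = 0\<^sub>v k"
  using mult_mat_zero_vec[OF full_rankD(2)[OF X]] .

lemma beta_hat_span: "b \<in> carrier_vec k \<Longrightarrow> beta_hat X (X *\<^sub>v b) = b"
  using beta_hat_shift[of "0\<^sub>v n" b] beta_hat_orthogonal[OF transpose_design_zero] full_rankD[OF X]
  by (simp add: left_zero_vec[of _ n])

lemma u_hat_span: "b \<in> carrier_vec k \<Longrightarrow> u_hat X (X *\<^sub>v b) = 0\<^sub>v n"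
  using u_hat_shift[of "0\<^sub>v n" b] u_hat_orthogonal[OF _ transpose_design_zero] full_rankD[OF X]
  by (simp add: left_zero_vec[of _ n])

text \<open>
  All these quantities depend on \<open>y\<close> only through its OLS residuals.
\<close>

lemma residual_statistics_shift:
  assumes "y \<in> carrier_vec n" "b \<in> carrier_vec k"
  shows "rho_num X (y + X *\<^sub>v b) = rho_num X y" "rho_den a\<^sub>1 a\<^sub>2 X (y + X *\<^sub>v b) = rho_den a\<^sub>1 a\<^sub>2 X y"
    "Lam_hat a\<^sub>1 a\<^sub>2 X (y + X *\<^sub>v b) = Lam_hat a\<^sub>1 a\<^sub>2 X y"
    "gls_gram a\<^sub>1 a\<^sub>2 X (y + X *\<^sub>v b) = gls_gram a\<^sub>1 a\<^sub>2 X y"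
    "ols_sandwich a\<^sub>1 a\<^sub>2 R X (y + X *\<^sub>v b) = ols_sandwich a\<^sub>1 a\<^sub>2 R X y"
    "sigma2_hat X (y + X *\<^sub>v b) = sigma2_hat X y"
  by (simp_all add: rho_num_def rho_den_def rho_hat_def Lam_hat_def gls_gram_def ols_sandwich_def
      sigma2_hat_def u_hat_shift[OF assms])

lemma rho_den_nonneg: "rho_den a\<^sub>1 a\<^sub>2 X y \<ge> 0"
  by (simp add: rho_den_def sum_nonneg)

text \<open>
  The denominator of \<open>rho_hat\<close> may omit only the first and the last squared residual, and two
  neighbouring indices are never both omitted. Hence the points outside \<open>N1\<close> automatically have a
  nonzero denominator, and the exclusion of \<open>N1\<close> becomes two polynomial conditions in the residuals.
\<close>

lemma rho_num_zero_if_den_zero: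
  assumes "rho_den a\<^sub>1 a\<^sub>2 X y = 0"
  shows "rho_num X y = 0"
proof -
  have z: "vec_index (u_hat X y) (t - 1) = 0" if "a\<^sub>1 \<le> t" "t \<le> a\<^sub>2" for t
    using assms that sum_nonneg_eq_0_iff[of "{a\<^sub>1..a\<^sub>2}" "\<lambda>t. (vec_index (u_hat X y) (t - 1))\<^sup>2"]
    by (simp add: rho_den_def)
  have "vec_index (u_hat X y) (t - 1) * vec_index (u_hat X y) (t - 2) = 0"
    if t: "t \<in> {2..dim_row X}" for t
  proof (cases "t \<le> a\<^sub>2")
    case True
    then show ?thesis using z[of t] t a1 by auto
  next
    case False
    then have "t - 1 = a\<^sub>2" using t a2 full_rankD(6)[OF X] by auto
    moreover have "t - 2 = t - 1 - 1" by simp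
    ultimately show ?thesis using z[of "t - 1"] a1_le by simp
  qed
  then show ?thesis unfolding rho_num_def by (intro sum.neutral) blast
qed

lemma notin_N1_iff:
  "y \<in> carrier_vec n \<Longrightarrow> y \<notin> N1 a\<^sub>1 a\<^sub>2 X \<longleftrightarrow>
     rho_den a\<^sub>1 a\<^sub>2 X y \<noteq> 0 \<and> (rho_num X y)\<^sup>2 - (rho_den a\<^sub>1 a\<^sub>2 X y)\<^sup>2 \<noteq> 0"
  using rho_num_zero_if_den_zero[of y] rho_den_nonneg[of y] full_rankD(6)[OF X]
  by (auto simp: N1_def power2_eq_iff abs_if)

lemma det_Lam_hat:
  assumes "rho_den a\<^sub>1 a\<^sub>2 X y \<noteq> 0" "(rho_num X y)\<^sup>2 - (rho_den a\<^sub>1 a\<^sub>2 X y)\<^sup>2 \<noteq> 0"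
  shows "det (Lam_hat a\<^sub>1 a\<^sub>2 X y) \<noteq> 0"
proof -
  have "\<bar>rho_hat a\<^sub>1 a\<^sub>2 X y\<bar> \<noteq> 1"
    using assms by (auto simp: rho_hat_def abs_if power2_eq_square field_simps split: if_splits)
  then show ?thesis unfolding Lam_hat_def by (rule det_Lam_nonzero)
qed

lemma Lam_hat_carrier: "Lam_hat a\<^sub>1 a\<^sub>2 X y \<in> carrier_mat n n"
  using ar1_carrier(3) full_rankD(6)[OF X] by (simp add: Lam_hat_def)

lemma notin_N2_star_iff:
  "y \<in> carrier_vec n \<Longrightarrow> y \<notin> N2_star a\<^sub>1 a\<^sub>2 R X \<longleftrightarrow>
     rho_den a\<^sub>1 a\<^sub>2 X y \<noteq> 0 \<and> (rho_num X y)\<^sup>2 - (rho_den a\<^sub>1 a\<^sub>2 X y)\<^sup>2 \<noteq> 0 \<and>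
     det (gls_gram a\<^sub>1 a\<^sub>2 X y) \<noteq> 0 \<and> sigma2_tilde a\<^sub>1 a\<^sub>2 X y \<noteq> 0 \<and>
     det (R * minv (gls_gram a\<^sub>1 a\<^sub>2 X y) * transpose_mat R) \<noteq> 0"
  using full_rankD(6)[OF X] notin_N1_iff[of y] by (auto simp: N2_star_def N2_def)

lemma notin_N0_star_iff:
  "y \<in> carrier_vec n \<Longrightarrow> y \<notin> N0_star a\<^sub>1 a\<^sub>2 R X \<longleftrightarrow>
     rho_den a\<^sub>1 a\<^sub>2 X y \<noteq> 0 \<and> det (ols_sandwich a\<^sub>1 a\<^sub>2 R X y) \<noteq> 0"
  using full_rankD(6)[OF X] by (auto simp: N0_star_def N0_def)

lemma gls_gram_carrier:
  assumes "det (Lam_hat a\<^sub>1 a\<^sub>2 X y) \<noteq> 0"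
  shows "gls_gram a\<^sub>1 a\<^sub>2 X y \<in> carrier_mat k k"
  using full_rankD[OF X] minv(1)[OF Lam_hat_carrier assms] by (simp add: gls_gram_def)

lemma beta_tilde_carrier:
  assumes "det (Lam_hat a\<^sub>1 a\<^sub>2 X y) \<noteq> 0" "det (gls_gram a\<^sub>1 a\<^sub>2 X y) \<noteq> 0"
  shows "beta_tilde a\<^sub>1 a\<^sub>2 X y \<in> carrier_vec k"
  unfolding beta_tilde_def
  using minv(1)[OF gls_gram_carrier[OF assms(1)] assms(2)] full_rankD[OF X]
  by (intro mult_mat_vec_carrier carrier_vecI) auto

lemma beta_tilde_shift:
  assumes y: "y \<in> carrier_vec n" and b: "b \<in> carrier_vec k"
    and nz: "det (Lam_hat a\<^sub>1 a\<^sub>2 X y) \<noteq> 0" "det (gls_gram a\<^sub>1 a\<^sub>2 X y) \<noteq> 0"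
  shows "beta_tilde a\<^sub>1 a\<^sub>2 X (y + X *\<^sub>v b) = beta_tilde a\<^sub>1 a\<^sub>2 X y + b"
  unfolding beta_tilde_def residual_statistics_shift[OF y b]
  using gls_coefficient_shift[OF full_rankD(1)[OF X] minv(1)[OF Lam_hat_carrier nz(1)] _ y b] nz(2)
  unfolding gls_gram_def by blast

lemma sigma2_tilde_shift:
  assumes y: "y \<in> carrier_vec n" and b: "b \<in> carrier_vec k"
    and nz: "det (Lam_hat a\<^sub>1 a\<^sub>2 X y) \<noteq> 0" "det (gls_gram a\<^sub>1 a\<^sub>2 X y) \<noteq> 0"
  shows "sigma2_tilde a\<^sub>1 a\<^sub>2 X (y + X *\<^sub>v b) = sigma2_tilde a\<^sub>1 a\<^sub>2 X y"
  unfolding sigma2_tilde_def beta_tilde_shift[OF assms] residual_statistics_shift[OF y b]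
    residual_shift[OF full_rankD(1)[OF X] y b beta_tilde_carrier[OF nz]] ..

lemma restriction_shift:
  assumes "b \<in> carrier_vec k" "R *\<^sub>v b = r" "c \<in> carrier_vec k"
  shows "R *\<^sub>v (c + b) - r = R *\<^sub>v c"
  unfolding mult_add_distrib_mat_vec[OF R assms(3,1)] assms(2)
  using R r by (intro eq_vecI) auto

lemma T_FGLS_shift:
  assumes y: "y \<in> carrier_vec n" and b: "b \<in> carrier_vec k" "R *\<^sub>v b = r"
    and N: "y \<notin> N2_star a\<^sub>1 a\<^sub>2 R X"
  shows "T_FGLS a\<^sub>1 a\<^sub>2 R r X (y + X *\<^sub>v b) =
    (R *\<^sub>v beta_tilde a\<^sub>1 a\<^sub>2 X y) \<bullet>
      (minv (Omega_tilde a\<^sub>1 a\<^sub>2 R X y) *\<^sub>v (R *\<^sub>v beta_tilde a\<^sub>1 a\<^sub>2 X y))"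
proof -
  have yb: "y + X *\<^sub>v b \<in> carrier_vec n" using y b full_rankD[OF X] by auto
  note nz = N[unfolded notin_N2_star_iff[OF y]]
  have L: "det (Lam_hat a\<^sub>1 a\<^sub>2 X y) \<noteq> 0" and G: "det (gls_gram a\<^sub>1 a\<^sub>2 X y) \<noteq> 0"
    using nz det_Lam_hat by blast+
  have "y + X *\<^sub>v b \<notin> N2_star a\<^sub>1 a\<^sub>2 R X"
    unfolding notin_N2_star_iff[OF yb] residual_statistics_shift[OF y b(1)] sigma2_tilde_shift[OF y b(1) L G]
    using nz .
  then show ?thesis
    by (simp add: T_FGLS_def Let_def Omega_tilde_def residual_statistics_shift[OF y b(1)]
        sigma2_tilde_shift[OF y b(1) L G] beta_tilde_shift[OF y b(1) L G]
        restriction_shift[OF b beta_tilde_carrier[OF L G]])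
qed

lemma T_OLS_shift:
  assumes y: "y \<in> carrier_vec n" and b: "b \<in> carrier_vec k" "R *\<^sub>v b = r"
    and N: "y \<notin> N0_star a\<^sub>1 a\<^sub>2 R X"
  shows "T_OLS a\<^sub>1 a\<^sub>2 R r X (y + X *\<^sub>v b) =
    (R *\<^sub>v beta_hat X y) \<bullet> (minv (Omega_hat a\<^sub>1 a\<^sub>2 R X y) *\<^sub>v (R *\<^sub>v beta_hat X y))"
proof -
  have yb: "y + X *\<^sub>v b \<in> carrier_vec n" using y b full_rankD[OF X] by auto
  have "y + X *\<^sub>v b \<notin> N0_star a\<^sub>1 a\<^sub>2 R X"
    unfolding notin_N0_star_iff[OF yb] residual_statistics_shift[OF y b(1)]
    using N[unfolded notin_N0_star_iff[OF y]] .
  then show ?thesis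
    by (simp add: T_OLS_def Let_def Omega_hat_def residual_statistics_shift[OF y b(1)]
        beta_hat_shift[OF y b(1)] restriction_shift[OF b beta_hat_carrier[OF y]])
qed

lemma rho_den_span:
  assumes "b \<in> carrier_vec k"
  shows "rho_den a\<^sub>1 a\<^sub>2 X (X *\<^sub>v b) = 0"
proof -
  have "t - 1 < n" if "t \<in> {a\<^sub>1..a\<^sub>2}" for t using that a2 k_less by auto
  then show ?thesis unfolding rho_den_def u_hat_span[OF assms] by (intro sum.neutral) auto
qed

lemma span_exceptional:
  assumes b: "b \<in> carrier_vec k"
  shows "X *\<^sub>v b \<in> N2_star a\<^sub>1 a\<^sub>2 R X" "X *\<^sub>v b \<in> N0_star a\<^sub>1 a\<^sub>2 R X"
proof -
  have Xb: "X *\<^sub>v b \<in> carrier_vec n" using b full_rankD[OF X] by auto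
  show "X *\<^sub>v b \<in> N2_star a\<^sub>1 a\<^sub>2 R X" "X *\<^sub>v b \<in> N0_star a\<^sub>1 a\<^sub>2 R X"
    using notin_N2_star_iff[OF Xb] notin_N0_star_iff[OF Xb] rho_den_span[OF b] by blast+
qed

lemma pos_quadratic_restriction:
  assumes "pos_quadratic k M" shows "pos_quadratic q (R * M * transpose_mat R)"
proof -
  have "pos_quadratic q (transpose_mat (transpose_mat R) * M * transpose_mat R)"
    using R transpose_R_inj by (intro pos_quadratic_congruence[OF assms]) auto
  then show ?thesis unfolding transpose_transpose .
qed

text \<open>
  For \<open>\<bar>rho_hat\<bar> < 1\<close> the estimated correlation matrix is positive definite. The Gram matrix, its
  inverse and the OLS sandwich arise from it by inversion and by congruence with injective
  matrices, so all are nonsingular; \<open>sigma2_tilde\<close> is a positive definite form in a residual that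
  is nonzero because \<open>y\<close> is not in the span of \<open>X\<close>.
\<close>

lemma regular_if_rho_lt_1:
  assumes y: "y \<in> carrier_vec n" and lt: "\<bar>rho_num X y\<bar> < rho_den a\<^sub>1 a\<^sub>2 X y"
  shows "y \<notin> N2_star a\<^sub>1 a\<^sub>2 R X" "y \<notin> N0_star a\<^sub>1 a\<^sub>2 R X"
proof -
  let ?L = "Lam_hat a\<^sub>1 a\<^sub>2 X y" and ?G = "gls_gram a\<^sub>1 a\<^sub>2 X y"
  note fr = full_rankD[OF X]
  have inj: "\<forall>v \<in> carrier_vec k. X *\<^sub>v v = 0\<^sub>v n \<longrightarrow> v = 0\<^sub>v k"
    using det_gram_nonzero_iff[OF fr(1)] fr(4) by blast
  have den: "rho_den a\<^sub>1 a\<^sub>2 X y \<noteq> 0" using lt by auto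
  have sq: "(rho_num X y)\<^sup>2 - (rho_den a\<^sub>1 a\<^sub>2 X y)\<^sup>2 \<noteq> 0"
    using lt by (auto simp: power2_eq_iff)
  have "\<bar>rho_hat a\<^sub>1 a\<^sub>2 X y\<bar> < 1" using lt by (auto simp: rho_hat_def abs_div field_simps)
  then have L: "pos_quadratic n ?L" unfolding Lam_hat_def fr(6) by (rule pos_quadratic_Lam)
  have G: "pos_quadratic k ?G"
    unfolding gls_gram_def by (rule pos_quadratic_congruence[OF pos_quadratic_minv[OF L] fr(1) inj])
  have bt: "beta_tilde a\<^sub>1 a\<^sub>2 X y \<in> carrier_vec k"
    using beta_tilde_carrier pos_quadratic_det[OF L] pos_quadratic_det[OF G] by blast
  define u where "u = y - X *\<^sub>v beta_tilde a\<^sub>1 a\<^sub>2 X y"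
  have Xbt: "X *\<^sub>v beta_tilde a\<^sub>1 a\<^sub>2 X y \<in> carrier_vec n" using fr bt by auto
  have u: "u \<in> carrier_vec n" using y Xbt by (simp add: u_def)
  have "u \<noteq> 0\<^sub>v n"
  proof
    assume 0: "u = 0\<^sub>v n"
    have "y = X *\<^sub>v beta_tilde a\<^sub>1 a\<^sub>2 X y"
    proof (rule eq_vecI)
      fix i assume "i < dim_vec (X *\<^sub>v beta_tilde a\<^sub>1 a\<^sub>2 X y)"
      then have i: "i < n" using fr by simp
      have "u $ i = y $ i - (X *\<^sub>v beta_tilde a\<^sub>1 a\<^sub>2 X y) $ i"
        unfolding u_def using i Xbt fr by (intro index_minus_vec) auto
      then show "y $ i = (X *\<^sub>v beta_tilde a\<^sub>1 a\<^sub>2 X y) $ i" using 0 i by simp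
    qed (use y fr in auto)
    then show False using rho_den_span[OF bt] den by simp
  qed
  then have "u \<bullet> (minv ?L *\<^sub>v u) > 0"
    using pos_quadratic_minv[OF L] u by (simp add: pos_quadratic_def)
  then have s: "sigma2_tilde a\<^sub>1 a\<^sub>2 X y \<noteq> 0"
    using k_less fr by (simp add: sigma2_tilde_def Let_def u_def)
  show "y \<notin> N2_star a\<^sub>1 a\<^sub>2 R X"
    unfolding notin_N2_star_iff[OF y]
    using den sq s pos_quadratic_det[OF G]
      pos_quadratic_det[OF pos_quadratic_restriction[OF pos_quadratic_minv[OF G]]] by blast
  \<comment> \<open>The sandwich is the congruence of the correlation matrix by \<open>B\<close>; its left factor is the
     transpose of \<open>B\<close> because the inverse Gram matrix is symmetric.\<close>
  let ?M = "minv (transpose_mat X * X)"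
  have Rt: "transpose_mat R \<in> carrier_mat k q" using R by simp
  define B where "B = X * (?M * transpose_mat R)"
  have MR: "?M * transpose_mat R \<in> carrier_mat k q" using fr Rt by auto
  have B: "B \<in> carrier_mat n q" using fr MR by (auto simp: B_def)
  have Msym: "transpose_mat ?M = ?M"
    using fr by (intro transpose_minv_symmetric[of _ k]) (auto simp: transpose_mult[of _ k n])
  have Binj: "\<forall>v \<in> carrier_vec q. B *\<^sub>v v = 0\<^sub>v n \<longrightarrow> v = 0\<^sub>v q"
  proof (intro ballI impI)
    fix v assume v: "v \<in> carrier_vec q" "B *\<^sub>v v = 0\<^sub>v n"
    have Rv: "transpose_mat R *\<^sub>v v \<in> carrier_vec k" using Rt v by auto
    have "X *\<^sub>v ((?M * transpose_mat R) *\<^sub>v v) = 0\<^sub>v n"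
      using v(2) unfolding B_def assoc_mult_mat_vec[OF fr(1) MR v(1)] .
    then have "(?M * transpose_mat R) *\<^sub>v v = 0\<^sub>v k" using inj MR v(1) by auto
    then have 0: "?M *\<^sub>v (transpose_mat R *\<^sub>v v) = 0\<^sub>v k"
      unfolding assoc_mult_mat_vec[OF fr(5) Rt v(1)] .
    have "transpose_mat R *\<^sub>v v = (transpose_mat X * X) *\<^sub>v (?M *\<^sub>v (transpose_mat R *\<^sub>v v))"
      using assoc_mult_mat_vec[OF fr(3) fr(5) Rv] minv(2)[OF fr(3,4)] Rv by simp
    also have "\<dots> = 0\<^sub>v k" unfolding 0 using mult_mat_zero_vec[OF fr(3)] .
    finally show "v = 0\<^sub>v q" using transpose_R_inj v(1) by blast
  qed
  have Bt: "transpose_mat B = R * ?M * transpose_mat X"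
    unfolding B_def transpose_mult[OF fr(1) MR] transpose_mult[OF fr(5) Rt] transpose_transpose Msym ..
  have RM: "R * ?M * transpose_mat X \<in> carrier_mat q n" using R fr by auto
  have RML: "R * ?M * transpose_mat X * ?L \<in> carrier_mat q n"
    using RM Lam_hat_carrier by (rule mult_carrier_mat)
  have "ols_sandwich a\<^sub>1 a\<^sub>2 R X y = R * ?M * transpose_mat X * ?L * X * (?M * transpose_mat R)"
    unfolding ols_sandwich_def
    using mult_carrier_mat[OF RML fr(1)] fr(5) Rt by (rule assoc_mult_mat)
  also have "\<dots> = R * ?M * transpose_mat X * ?L * B"
    unfolding B_def using RML fr(1) MR by (rule assoc_mult_mat)
  finally have "ols_sandwich a\<^sub>1 a\<^sub>2 R X y = transpose_mat B * ?L * B" unfolding Bt .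
  then have "det (ols_sandwich a\<^sub>1 a\<^sub>2 R X y) \<noteq> 0"
    using pos_quadratic_det[OF pos_quadratic_congruence[OF L B Binj]] by simp
  then show "y \<notin> N0_star a\<^sub>1 a\<^sub>2 R X" unfolding notin_N0_star_iff[OF y] using den by blast
qed

end

end

section \<open>Exceptional parameters of a rational family of designs\<close>

abbreviation product_null_sets :: "'i set \<Rightarrow> ('i \<Rightarrow> real) set set" where
  "product_null_sets I \<equiv> null_sets (completion (\<Pi>\<^sub>M i \<in> I. (lborel :: real measure)))"

text \<open>
  A family of designs whose entries are rational in the parameter \<open>x\<close>, together with one parameter
  \<open>x\<^sub>0\<close> at which the estimated autocorrelation of \<open>e\<close> lies in \<open>(-1, 1)\<close>. The family is used both for an
  unrestricted design and for a design with an intercept column.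
\<close>

locale design_family = linear_restriction n k q a\<^sub>1 a\<^sub>2 R r
  for n k q a\<^sub>1 a\<^sub>2 :: nat and R :: "real mat" and r :: "real vec" +
  fixes I :: "'i set" and X :: "('i \<Rightarrow> real) \<Rightarrow> real mat" and e :: "real vec" and x\<^sub>0 :: "'i \<Rightarrow> real"
  assumes I: "finite I" and rational_X: "rational_mat I (I \<rightarrow>\<^sub>E UNIV) n k X"
    and e: "e \<in> carrier_vec n"
    and x0: "x\<^sub>0 \<in> I \<rightarrow>\<^sub>E UNIV" and full_rank_x0: "full_rank (X x\<^sub>0)"
    and rho_x0: "\<bar>rho_num (X x\<^sub>0) e\<bar> < rho_den a\<^sub>1 a\<^sub>2 (X x\<^sub>0) e"
begin

text \<open>
  Each of the following sets removes from an earlier one the zeros of a function that is rational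
  there, and the quantities computed next are rational on the smaller set; for \<open>U_fgls\<close> and \<open>U_ols\<close>
  this is the content of \<open>U_fgls_eq\<close> and \<open>U_ols_eq\<close>. They all contain \<open>x\<^sub>0\<close>, so every removed set
  is null.
\<close>

definition U_rank where "U_rank = {x \<in> I \<rightarrow>\<^sub>E UNIV. full_rank (X x)}"

definition U_den where "U_den = {x \<in> U_rank. rho_den a\<^sub>1 a\<^sub>2 (X x) e \<noteq> 0}"

definition U_rho where
  "U_rho = {x \<in> U_den. (rho_num (X x) e)\<^sup>2 - (rho_den a\<^sub>1 a\<^sub>2 (X x) e)\<^sup>2 \<noteq> 0}"

definition U_gram where "U_gram = {x \<in> U_rho. det (gls_gram a\<^sub>1 a\<^sub>2 (X x) e) \<noteq> 0}"

definition U_sigma where "U_sigma = {x \<in> U_gram. sigma2_tilde a\<^sub>1 a\<^sub>2 (X x) e \<noteq> 0}"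

definition U_fgls where "U_fgls = {x \<in> U_rank. e \<notin> N2_star a\<^sub>1 a\<^sub>2 R (X x)}"

definition U_ols where "U_ols = {x \<in> U_rank. e \<notin> N0_star a\<^sub>1 a\<^sub>2 R (X x)}"

lemma U_nested:
  "U_rank \<subseteq> I \<rightarrow>\<^sub>E UNIV" "U_den \<subseteq> U_rank" "U_rho \<subseteq> U_den" "U_gram \<subseteq> U_rho" "U_sigma \<subseteq> U_gram"
  by (auto simp: U_rank_def U_den_def U_rho_def U_gram_def U_sigma_def)

lemma in_U_rank: "x \<in> U_rank \<Longrightarrow> full_rank (X x)"
  by (simp add: U_rank_def)

lemma U_fgls_eq:
  "U_fgls = {x \<in> U_sigma. det (R * minv (gls_gram a\<^sub>1 a\<^sub>2 (X x) e) * transpose_mat R) \<noteq> 0}"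
  using notin_N2_star_iff[OF in_U_rank e]
  by (auto simp: U_fgls_def U_sigma_def U_gram_def U_rho_def U_den_def)

lemma U_ols_eq: "U_ols = {x \<in> U_den. det (ols_sandwich a\<^sub>1 a\<^sub>2 R (X x) e) \<noteq> 0}"
  using notin_N0_star_iff[OF in_U_rank e] by (auto simp: U_ols_def U_den_def)

lemma x0_regular: "x\<^sub>0 \<in> U_fgls" "x\<^sub>0 \<in> U_ols" "x\<^sub>0 \<in> U_sigma" "x\<^sub>0 \<in> U_gram" "x\<^sub>0 \<in> U_rho" "x\<^sub>0 \<in> U_den" "x\<^sub>0 \<in> U_rank"
proof -
  show r: "x\<^sub>0 \<in> U_rank" using x0 full_rank_x0 by (simp add: U_rank_def)
  show f: "x\<^sub>0 \<in> U_fgls" and "x\<^sub>0 \<in> U_ols"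
    using regular_if_rho_lt_1[OF full_rank_x0 e rho_x0] r by (simp_all add: U_fgls_def U_ols_def)
  show "x\<^sub>0 \<in> U_sigma" using f unfolding U_fgls_eq by simp
  then show "x\<^sub>0 \<in> U_gram" "x\<^sub>0 \<in> U_rho" "x\<^sub>0 \<in> U_den" using U_nested by blast+
qed

lemma null_zeros:
  assumes "U \<subseteq> I \<rightarrow>\<^sub>E UNIV" "rational_on I U f" "x\<^sub>0 \<in> U" "f x\<^sub>0 \<noteq> 0"
  shows "{x \<in> U. f x = 0} \<in> product_null_sets I"
  using rational_zeros_null[OF I assms] .

lemma rational_gram: "rational_mat I (I \<rightarrow>\<^sub>E UNIV) k k (\<lambda>x. transpose_mat (X x) * X x)"
  by (intro rational_mat_mult[of _ _ _ n] rational_mat_transpose rational_X)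

lemma rank_deficient_null: "{x \<in> I \<rightarrow>\<^sub>E UNIV. \<not> full_rank (X x)} \<in> product_null_sets I"
proof -
  have "{x \<in> I \<rightarrow>\<^sub>E UNIV. det (transpose_mat (X x) * X x) = 0} \<in> product_null_sets I"
    using full_rankD(4)[OF full_rank_x0] x0
    by (intro null_zeros rational_det[OF rational_gram]) auto
  moreover have "{x \<in> I \<rightarrow>\<^sub>E UNIV. \<not> full_rank (X x)} =
      {x \<in> I \<rightarrow>\<^sub>E UNIV. det (transpose_mat (X x) * X x) = 0}"
    using rational_matD(1)[OF rational_X] by (auto simp: full_rank_def)
  ultimately show ?thesis by simp
qed

lemmas rational_X_rank = rational_mat_subset[OF rational_X U_nested(1)]

lemma rational_gram_inverse: "rational_mat I U_rank k k (\<lambda>x. minv (transpose_mat (X x) * X x))"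
  using full_rankD(4)[OF in_U_rank]
  by (intro rational_minv rational_mat_subset[OF rational_gram U_nested(1)])

lemma rational_beta_hat: "rational_vec I U_rank k (\<lambda>x. beta_hat (X x) e)"
  unfolding beta_hat_def
  by (intro rational_mat_vec[where l = k] rational_mat_vec[where l = n]
      rational_gram_inverse rational_mat_transpose rational_X_rank
      rational_vec_const[OF e])

lemma rational_u_hat: "rational_vec I U_rank n (\<lambda>x. u_hat (X x) e)"
  unfolding u_hat_def
  by (intro rational_mat_vec[where l = k] rational_vec_diff rational_beta_hat rational_X_rank
      rational_vec_const[OF e])

lemma rational_rho_num: "rational_on I U_rank (\<lambda>x. rho_num (X x) e)"
proof (rule rational_on_cong)
  show "rational_on I U_rank (\<lambda>x. \<Sum>t = 2..n. u_hat (X x) e $ (t - 1) * u_hat (X x) e $ (t - 2))"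
    by (intro rational_on_sum rational_on_mult rational_vecD(3)[OF rational_u_hat]) auto
qed (use full_rankD(6)[OF in_U_rank] in \<open>simp add: rho_num_def\<close>)

lemma rational_rho_den: "rational_on I U_rank (\<lambda>x. rho_den a\<^sub>1 a\<^sub>2 (X x) e)"
  unfolding rho_den_def
proof (intro rational_on_sum rational_on_power rational_vecD(3)[OF rational_u_hat])
  fix t assume "t \<in> {a\<^sub>1..a\<^sub>2}"
  then show "t - 1 < n" using a2 k_less by auto
qed simp

lemma rational_Lam_hat: "rational_mat I U_den n n (\<lambda>x. Lam_hat a\<^sub>1 a\<^sub>2 (X x) e)"
proof (rule rational_matI)
  fix x assume "x \<in> U_den"
  then show "Lam_hat a\<^sub>1 a\<^sub>2 (X x) e \<in> carrier_mat n n"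
    using Lam_hat_carrier in_U_rank U_nested(2) by blast
next
  fix i j assume ij: "i < n" "j < n"
  have "rational_on I U_den (\<lambda>x. rho_hat a\<^sub>1 a\<^sub>2 (X x) e)"
    unfolding rho_hat_def
    by (intro rational_on_divide rational_on_subset[OF rational_rho_num U_nested(2)]
        rational_on_subset[OF rational_rho_den U_nested(2)]) (simp add: U_den_def)
  then have "rational_on I U_den (\<lambda>x. rho_hat a\<^sub>1 a\<^sub>2 (X x) e ^ nat \<bar>int i - int j\<bar>)"
    by (rule rational_on_power)
  then show "rational_on I U_den (\<lambda>x. Lam_hat a\<^sub>1 a\<^sub>2 (X x) e $$ (i, j))"
  proof (rule rational_on_cong)
    fix x assume "x \<in> U_den"
    then have "dim_row (X x) = n" using full_rankD(6) in_U_rank U_nested(2) by blast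
    then show "Lam_hat a\<^sub>1 a\<^sub>2 (X x) e $$ (i, j) = rho_hat a\<^sub>1 a\<^sub>2 (X x) e ^ nat \<bar>int i - int j\<bar>"
      using ij by (simp add: Lam_hat_def Lam_def)
  qed
qed

lemma U_rank_minus_U_den_null: "{x \<in> U_rank. rho_den a\<^sub>1 a\<^sub>2 (X x) e = 0} \<in> product_null_sets I"
  using x0_regular by (intro null_zeros rational_rho_den U_nested(1)) (auto simp: U_den_def)

lemma rational_ols_sandwich: "rational_mat I U_den q q (\<lambda>x. ols_sandwich a\<^sub>1 a\<^sub>2 R (X x) e)"
  unfolding ols_sandwich_def
  by (rule rational_mat_mult[of _ _ _ k] rational_mat_mult[of _ _ _ n] rational_mat_const[OF R] rational_Lam_hat
      rational_mat_transpose rational_mat_subset[OF rational_gram_inverse U_nested(2)]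
      rational_mat_subset[OF rational_X_rank U_nested(2)])+

lemma ols_exceptional_null: "U_rank - U_ols \<in> product_null_sets I"
proof -
  have "{x \<in> U_den. det (ols_sandwich a\<^sub>1 a\<^sub>2 R (X x) e) = 0} \<in> product_null_sets I"
    using U_nested x0_regular(2,6)
    by (intro null_zeros rational_det[OF rational_ols_sandwich]) (auto simp: U_ols_eq)
  moreover have "U_rank - U_ols = {x \<in> U_rank. rho_den a\<^sub>1 a\<^sub>2 (X x) e = 0} \<union>
      {x \<in> U_den. det (ols_sandwich a\<^sub>1 a\<^sub>2 R (X x) e) = 0}"
    unfolding U_ols_eq using U_nested by (auto simp: U_den_def)
  ultimately show ?thesis using U_rank_minus_U_den_null by auto
qed

lemma U_ols_subset: "U_ols \<subseteq> U_den" "U_ols \<subseteq> U_rank"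
  by (auto simp: U_ols_eq U_den_def)

text \<open>
  Both test statistics have this shape: \<open>s\<close> is the variance estimate and \<open>S\<close> the estimated
  covariance matrix of the restrictions up to that factor.
\<close>

lemma rational_quadratic_form_inverse:
  assumes v: "rational_vec I U q v" and S: "rational_mat I U q q S"
    and s: "rational_on I U s" "\<And>x. x \<in> U \<Longrightarrow> s x \<noteq> 0" and nz: "\<And>x. x \<in> U \<Longrightarrow> det (S x) \<noteq> 0"
  shows "rational_on I U (\<lambda>x. v x \<bullet> (minv (s x \<cdot>\<^sub>m S x) *\<^sub>v v x))"
proof (intro rational_scalar_prod[OF v] rational_mat_vec[OF _ v] rational_minv rational_mat_smult s(1) S)
  fix x assume x: "x \<in> U"
  show "det (s x \<cdot>\<^sub>m S x) \<noteq> 0"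
    using s(2)[OF x] nz[OF x] rational_matD(3)[OF S x] by (simp add: det_smult)
qed

lemma sigma2_hat_nonzero:
  assumes "x \<in> U_den" shows "sigma2_hat (X x) e \<noteq> 0"
proof
  have fr: "full_rank (X x)" using assms U_nested(2) in_U_rank by blast
  note u = u_hat_carrier[OF fr e]
  assume "sigma2_hat (X x) e = 0"
  then have "u_hat (X x) e \<bullet> u_hat (X x) e = 0"
    using full_rankD(6,7)[OF fr] k_less by (simp add: sigma2_hat_def)
  then have z: "u_hat (X x) e = 0\<^sub>v n" using scalar_prod_self_pos[OF u] by force
  have "t - 1 < n" if "t \<in> {a\<^sub>1..a\<^sub>2}" for t using that a2 k_less by auto
  then have "rho_den a\<^sub>1 a\<^sub>2 (X x) e = 0" unfolding rho_den_def z by (intro sum.neutral) auto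
  then show False using assms by (simp add: U_den_def)
qed

lemma rational_T_OLS:
  "rational_on I U_ols (\<lambda>x. (R *\<^sub>v beta_hat (X x) e) \<bullet>
     (minv (Omega_hat a\<^sub>1 a\<^sub>2 R (X x) e) *\<^sub>v (R *\<^sub>v beta_hat (X x) e)))"
  unfolding Omega_hat_def
proof (rule rational_quadratic_form_inverse)
  show "rational_vec I U_ols q (\<lambda>x. R *\<^sub>v beta_hat (X x) e)"
    by (intro rational_mat_vec[where l = k] rational_mat_const[OF R]
        rational_vec_subset[OF rational_beta_hat U_ols_subset(2)])
  show "rational_mat I U_ols q q (\<lambda>x. ols_sandwich a\<^sub>1 a\<^sub>2 R (X x) e)"
    by (rule rational_mat_subset[OF rational_ols_sandwich U_ols_subset(1)])
  have "rational_on I U_rank (\<lambda>x. sigma2_hat (X x) e)"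
  proof (rule rational_on_cong)
    show "rational_on I U_rank (\<lambda>x. (u_hat (X x) e \<bullet> u_hat (X x) e) / real (n - k))"
      using k_less
      by (intro rational_on_divide rational_scalar_prod[OF rational_u_hat rational_u_hat]
          rational_on_const) auto
  qed (use full_rankD(6,7)[OF in_U_rank] in \<open>simp add: sigma2_hat_def\<close>)
  then show "rational_on I U_ols (\<lambda>x. sigma2_hat (X x) e)"
    by (rule rational_on_subset[OF _ U_ols_subset(2)])
  show "sigma2_hat (X x) e \<noteq> 0" if "x \<in> U_ols" for x
    using sigma2_hat_nonzero U_ols_subset(1) that by blast
  show "det (ols_sandwich a\<^sub>1 a\<^sub>2 R (X x) e) \<noteq> 0" if "x \<in> U_ols" for x
    using that by (simp add: U_ols_eq)
qed

lemma U_rho_regular: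
  "x \<in> U_rho \<Longrightarrow> det (Lam_hat a\<^sub>1 a\<^sub>2 (X x) e) \<noteq> 0"
  using det_Lam_hat in_U_rank by (auto simp: U_rho_def U_den_def)

lemma rational_precision: "rational_mat I U_rho n n (\<lambda>x. minv (Lam_hat a\<^sub>1 a\<^sub>2 (X x) e))"
  by (intro rational_minv rational_mat_subset[OF rational_Lam_hat U_nested(3)] U_rho_regular)

lemma rational_X_rho: "rational_mat I U_rho n k X"
  using rational_mat_subset[OF rational_X_rank] U_nested by blast

lemma rational_gls_gram: "rational_mat I U_rho k k (\<lambda>x. gls_gram a\<^sub>1 a\<^sub>2 (X x) e)"
  unfolding gls_gram_def
  by (intro rational_mat_mult[of _ _ _ n] rational_mat_transpose rational_X_rho rational_precision)

lemma rational_gls_gram_inverse: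
  "rational_mat I U_gram k k (\<lambda>x. minv (gls_gram a\<^sub>1 a\<^sub>2 (X x) e))"
  by (intro rational_minv rational_mat_subset[OF rational_gls_gram U_nested(4)]) (simp add: U_gram_def)

lemma rational_beta_tilde: "rational_vec I U_gram k (\<lambda>x. beta_tilde a\<^sub>1 a\<^sub>2 (X x) e)"
  unfolding beta_tilde_def
  by (intro rational_mat_vec[where l = k] rational_mat_vec[where l = n] rational_gls_gram_inverse
      rational_vec_const[OF e]
      rational_mat_transpose rational_mat_subset[OF rational_X_rho U_nested(4)]
      rational_mat_subset[OF rational_precision U_nested(4)])

lemma rational_sigma2_tilde: "rational_on I U_gram (\<lambda>x. sigma2_tilde a\<^sub>1 a\<^sub>2 (X x) e)"
proof (rule rational_on_cong)
  let ?u = "\<lambda>x. e - X x *\<^sub>v beta_tilde a\<^sub>1 a\<^sub>2 (X x) e"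
  have u: "rational_vec I U_gram n ?u"
    by (intro rational_vec_diff rational_vec_const[OF e] rational_mat_vec[where l = k] rational_beta_tilde
        rational_mat_subset[OF rational_X_rho U_nested(4)])
  show "rational_on I U_gram (\<lambda>x. ?u x \<bullet> (minv (Lam_hat a\<^sub>1 a\<^sub>2 (X x) e) *\<^sub>v ?u x) / real (n - k))"
    using k_less
    by (intro rational_on_divide rational_scalar_prod[OF u] rational_mat_vec[OF _ u]
        rational_mat_subset[OF rational_precision U_nested(4)] rational_on_const) auto
  fix x assume "x \<in> U_gram"
  then have "full_rank (X x)" using U_nested in_U_rank by blast
  then show "sigma2_tilde a\<^sub>1 a\<^sub>2 (X x) e =
      ?u x \<bullet> (minv (Lam_hat a\<^sub>1 a\<^sub>2 (X x) e) *\<^sub>v ?u x) / real (n - k)"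
    using full_rankD(6,7) by (simp add: sigma2_tilde_def Let_def)
qed

lemma rational_fgls_middle:
  "rational_mat I U_gram q q (\<lambda>x. R * minv (gls_gram a\<^sub>1 a\<^sub>2 (X x) e) * transpose_mat R)"
  by (intro rational_mat_mult[of _ _ _ k] rational_mat_const R rational_gls_gram_inverse)
    (use R in simp)

lemma fgls_exceptional_null: "U_rank - U_fgls \<in> product_null_sets I"
proof -
  let ?S = "\<lambda>x. R * minv (gls_gram a\<^sub>1 a\<^sub>2 (X x) e) * transpose_mat R"
  have sub: "U_den \<subseteq> I \<rightarrow>\<^sub>E UNIV" "U_rho \<subseteq> I \<rightarrow>\<^sub>E UNIV" "U_gram \<subseteq> I \<rightarrow>\<^sub>E UNIV" "U_sigma \<subseteq> I \<rightarrow>\<^sub>E UNIV"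
    using U_nested by blast+
  have "{x \<in> U_den. (rho_num (X x) e)\<^sup>2 - (rho_den a\<^sub>1 a\<^sub>2 (X x) e)\<^sup>2 = 0} \<in> product_null_sets I"
    using x0_regular(5,6)
    by (intro null_zeros sub rational_on_diff rational_on_power
        rational_on_subset[OF rational_rho_num U_nested(2)]
        rational_on_subset[OF rational_rho_den U_nested(2)]) (auto simp: U_rho_def)
  moreover have "{x \<in> U_rho. det (gls_gram a\<^sub>1 a\<^sub>2 (X x) e) = 0} \<in> product_null_sets I"
    using x0_regular(4,5)
    by (intro null_zeros sub rational_det[OF rational_gls_gram]) (auto simp: U_gram_def)
  moreover have "{x \<in> U_gram. sigma2_tilde a\<^sub>1 a\<^sub>2 (X x) e = 0} \<in> product_null_sets I"
    using x0_regular(3,4)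
    by (intro null_zeros sub rational_sigma2_tilde) (auto simp: U_sigma_def)
  moreover have "{x \<in> U_sigma. det (?S x) = 0} \<in> product_null_sets I"
    using x0_regular(1,3)
    by (intro null_zeros sub rational_det[where m = q] rational_mat_subset[OF rational_fgls_middle U_nested(5)])
      (auto simp: U_fgls_eq)
  moreover have "U_rank - U_fgls = {x \<in> U_rank. rho_den a\<^sub>1 a\<^sub>2 (X x) e = 0} \<union>
      ({x \<in> U_den. (rho_num (X x) e)\<^sup>2 - (rho_den a\<^sub>1 a\<^sub>2 (X x) e)\<^sup>2 = 0} \<union>
      ({x \<in> U_rho. det (gls_gram a\<^sub>1 a\<^sub>2 (X x) e) = 0} \<union>
      ({x \<in> U_gram. sigma2_tilde a\<^sub>1 a\<^sub>2 (X x) e = 0} \<union> {x \<in> U_sigma. det (?S x) = 0})))"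
    unfolding U_fgls_eq using U_nested
    by (auto simp: U_den_def U_rho_def U_gram_def U_sigma_def)
  ultimately show ?thesis using U_rank_minus_U_den_null by (simp only:) (intro null_sets.Un)
qed

lemma U_fgls_subset: "U_fgls \<subseteq> U_sigma" "U_fgls \<subseteq> U_gram"
  using U_nested(5) by (auto simp: U_fgls_eq)

lemma rational_T_FGLS:
  "rational_on I U_fgls (\<lambda>x. (R *\<^sub>v beta_tilde a\<^sub>1 a\<^sub>2 (X x) e) \<bullet>
     (minv (Omega_tilde a\<^sub>1 a\<^sub>2 R (X x) e) *\<^sub>v (R *\<^sub>v beta_tilde a\<^sub>1 a\<^sub>2 (X x) e)))"
  unfolding Omega_tilde_def
proof (rule rational_quadratic_form_inverse)
  show "rational_vec I U_fgls q (\<lambda>x. R *\<^sub>v beta_tilde a\<^sub>1 a\<^sub>2 (X x) e)"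
    by (intro rational_mat_vec[where l = k] rational_mat_const[OF R]
        rational_vec_subset[OF rational_beta_tilde U_fgls_subset(2)])
  show "rational_mat I U_fgls q q (\<lambda>x. R * minv (gls_gram a\<^sub>1 a\<^sub>2 (X x) e) * transpose_mat R)"
    by (rule rational_mat_subset[OF rational_fgls_middle U_fgls_subset(2)])
  show "rational_on I U_fgls (\<lambda>x. sigma2_tilde a\<^sub>1 a\<^sub>2 (X x) e)"
    by (rule rational_on_subset[OF rational_sigma2_tilde U_fgls_subset(2)])
  show "sigma2_tilde a\<^sub>1 a\<^sub>2 (X x) e \<noteq> 0" if "x \<in> U_fgls" for x
    using U_fgls_subset(1) that by (auto simp: U_sigma_def)
  show "det (R * minv (gls_gram a\<^sub>1 a\<^sub>2 (X x) e) * transpose_mat R) \<noteq> 0" if "x \<in> U_fgls" for x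
    using that by (simp add: U_fgls_eq)
qed

end

section \<open>Null sets of designs\<close>

lemma lebesgue_mat_nullI:
  assumes "A \<subseteq> carrier_mat n m"
    and "{f \<in> ({..<n} \<times> {..<m}) \<rightarrow>\<^sub>E UNIV. mat n m f \<in> A} \<in> product_null_sets ({..<n} \<times> {..<m})"
  shows "A \<in> null_sets (lebesgue_mat n m)"
  using assms by (simp add: null_sets_lebesgue_mat_iff)

lemma lebesgue_mat_null_subset:
  assumes "A \<subseteq> B" "B \<in> null_sets (lebesgue_mat n m)"
  shows "A \<in> null_sets (lebesgue_mat n m)"
proof -
  have "{f \<in> ({..<n} \<times> {..<m}) \<rightarrow>\<^sub>E UNIV. mat n m f \<in> A} \<subseteq>
      {f \<in> ({..<n} \<times> {..<m}) \<rightarrow>\<^sub>E UNIV. mat n m f \<in> B}" using assms(1) by blast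
  then show ?thesis
    using assms unfolding null_sets_lebesgue_mat_iff by (blast intro: null_sets_completion_subset)
qed

lemma e_carrier: "e_plus n \<in> carrier_vec n" "e_minus n \<in> carrier_vec n"
  by (simp_all add: e_plus_def e_minus_def)

lemma with_intercept_carrier:
  "Xt \<in> carrier_mat n (k - 1) \<Longrightarrow> 1 \<le> k \<Longrightarrow> with_intercept n Xt \<in> carrier_mat n k"
  using mat_of_cols_carrier(1)[of n "e_plus n # cols Xt"] by (auto simp: with_intercept_def)

lemma with_intercept_index:
  assumes "Xt \<in> carrier_mat n (k - 1)" "i < n" "j < k"
  shows "with_intercept n Xt $$ (i, j) = (if j = 0 then 1 else Xt $$ (i, j - 1))"
  using assms
  by (cases j) (simp_all add: with_intercept_def mat_of_cols_index e_plus_def)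

lemma with_intercept_unit_vec:
  assumes "Xt \<in> carrier_mat n (k - 1)" "1 \<le> k"
  shows "with_intercept n Xt *\<^sub>v unit_vec k 0 = e_plus n"
proof -
  note c = with_intercept_carrier[OF assms]
  have "with_intercept n Xt *\<^sub>v unit_vec k 0 = col (with_intercept n Xt) 0"
    using mult_unit_vec[OF c] assms(2) by simp
  also have "\<dots> = e_plus n"
    using c assms by (intro eq_vecI) (auto simp: e_plus_def with_intercept_index)
  finally show ?thesis .
qed

text \<open>
  What the FGLS and the OLS test have in common. The value \<open>core X e\<close> is the statistic after the null
  mean has been eliminated; it is rational in the design outside the exceptional set, whereas \<open>T\<close>
  itself takes the default value \<open>0\<close> on that set.
\<close>

locale regular_test = linear_restriction n k q a\<^sub>1 a\<^sub>2 R r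
  for n k q a\<^sub>1 a\<^sub>2 :: nat and R :: "real mat" and r :: "real vec" +
  fixes N :: "real mat \<Rightarrow> real vec set" and T core :: "real mat \<Rightarrow> real vec \<Rightarrow> real"
  assumes T_shift: "\<lbrakk>full_rank X; e \<in> carrier_vec n; b \<in> carrier_vec k; R *\<^sub>v b = r; e \<notin> N X\<rbrakk> \<Longrightarrow>
      T X (e + X *\<^sub>v b) = core X e"
    and span_in_N: "\<lbrakk>full_rank X; b \<in> carrier_vec k\<rbrakk> \<Longrightarrow> X *\<^sub>v b \<in> N X"
    and exceptional_null: "design_family n k q a\<^sub>1 a\<^sub>2 R r (I :: (nat \<times> nat) set) D e x\<^sub>0 \<Longrightarrow>
      {x \<in> I \<rightarrow>\<^sub>E UNIV. full_rank (D x) \<and> e \<in> N (D x)} \<in> product_null_sets I"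
    and rational_core: "design_family n k q a\<^sub>1 a\<^sub>2 R r (I :: (nat \<times> nat) set) D e x\<^sub>0 \<Longrightarrow>
      rational_on I {x \<in> I \<rightarrow>\<^sub>E UNIV. full_rank (D x) \<and> e \<notin> N (D x)} (\<lambda>x. core (D x) e)"
begin

lemma null_meansE:
  assumes "full_rank X" "\<mu> \<in> null_means R r X"
  obtains b where "b \<in> carrier_vec k" "R *\<^sub>v b = r" "\<mu> = X *\<^sub>v b"
  using assms full_rankD(7) by (auto simp: null_means_def)

lemma null_means_nonempty: "full_rank X \<Longrightarrow> \<exists>\<mu>. \<mu> \<in> null_means R r X"
  using restricted_coefficient_exists full_rankD(7) by (auto simp: null_means_def)

lemma T_null_means:
  assumes "full_rank X" "e \<in> carrier_vec n" "e \<notin> N X" "\<mu> \<in> null_means R r X"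
  shows "T X (e + \<mu>) = core X e"
proof -
  obtain b where "b \<in> carrier_vec k" "R *\<^sub>v b = r" "\<mu> = X *\<^sub>v b"
    using null_meansE[OF assms(1,4)] .
  then show ?thesis using T_shift[OF assms(1,2) _ _ assms(3)] by blast
qed

lemma ex_T_iff:
  assumes "full_rank X" "e \<in> carrier_vec n" "e \<notin> N X"
  shows "(\<exists>\<mu> \<in> null_means R r X. T X (e + \<mu>) = C) \<longleftrightarrow> core X e = C"
    and "(\<forall>\<mu> \<in> null_means R r X. T X (e + \<mu>) = C) \<longleftrightarrow> core X e = C"
  using T_null_means[OF assms] null_means_nonempty[OF assms(1)] by auto

lemma not_covered_imp_eq:
  assumes X: "full_rank X" and e: "e \<in> {e_plus n, e_minus n}" and N: "e \<notin> N X"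
    and nc: "\<not> covered R r C N T X"
  shows "core X e = C"
proof -
  have ec: "e \<in> carrier_vec n" using e e_carrier by auto
  obtain \<mu> where mu: "\<mu> \<in> null_means R r X" using null_means_nonempty[OF X] by blast
  have "\<not> T X (e + \<mu>) > C" "\<not> T X (e + \<mu>) < C"
    using nc e N mu unfolding covered_def full_rankD(6)[OF X] by blast+
  then show ?thesis using T_null_means[OF X ec N mu] by simp
qed

text \<open>
  The map \<open>\<Phi>\<close> turns the free part of the design into the design: it is the identity for an
  unrestricted design and prepends the intercept otherwise.
\<close>

lemma exceptional_design_sets:
  assumes rat: "rational_mat ({..<n} \<times> {..<m}) (({..<n} \<times> {..<m}) \<rightarrow>\<^sub>E UNIV) n k (\<lambda>f. \<Phi> (mat n m f))"
    and e: "e \<in> carrier_vec n" and Y0: "Y\<^sub>0 \<in> carrier_mat n m"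
    and full: "full_rank (\<Phi> Y\<^sub>0)" and lt: "\<bar>rho_num (\<Phi> Y\<^sub>0) e\<bar> < rho_den a\<^sub>1 a\<^sub>2 (\<Phi> Y\<^sub>0) e"
  shows "{Y \<in> carrier_mat n m. \<not> full_rank (\<Phi> Y)} \<in> null_sets (lebesgue_mat n m)"
    and "{Y \<in> carrier_mat n m. full_rank (\<Phi> Y) \<and> e \<in> N (\<Phi> Y)} \<in> null_sets (lebesgue_mat n m)"
    and "\<lbrakk>Z \<in> carrier_mat n m; full_rank (\<Phi> Z); e \<notin> N (\<Phi> Z); core (\<Phi> Z) e \<noteq> C\<rbrakk> \<Longrightarrow>
      {Y \<in> carrier_mat n m. full_rank (\<Phi> Y) \<and> e \<notin> N (\<Phi> Y) \<and> core (\<Phi> Y) e = C}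
        \<in> null_sets (lebesgue_mat n m)"
proof -
  let ?I = "{..<n} \<times> {..<m}" and ?D = "\<lambda>f. \<Phi> (mat n m f)"
  have ex: "\<exists>f \<in> ?I \<rightarrow>\<^sub>E UNIV. mat n m f = Y" if "Y \<in> carrier_mat n m" for Y :: "real mat"
    using that unfolding mat_image_PiE[symmetric] by blast
  obtain x\<^sub>0 where x0: "x\<^sub>0 \<in> ?I \<rightarrow>\<^sub>E UNIV" "mat n m x\<^sub>0 = Y\<^sub>0" using ex[OF Y0] by blast
  have df: "design_family n k q a\<^sub>1 a\<^sub>2 R r ?I ?D e x\<^sub>0"
    using rat e x0 full lt by unfold_locales auto
  show "{Y \<in> carrier_mat n m. \<not> full_rank (\<Phi> Y)} \<in> null_sets (lebesgue_mat n m)"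
    using design_family.rank_deficient_null[OF df] by (intro lebesgue_mat_nullI) auto
  show "{Y \<in> carrier_mat n m. full_rank (\<Phi> Y) \<and> e \<in> N (\<Phi> Y)} \<in> null_sets (lebesgue_mat n m)"
    using exceptional_null[OF df] by (intro lebesgue_mat_nullI) auto
  assume Z: "Z \<in> carrier_mat n m" "full_rank (\<Phi> Z)" "e \<notin> N (\<Phi> Z)" "core (\<Phi> Z) e \<noteq> C"
  obtain z where z: "z \<in> ?I \<rightarrow>\<^sub>E UNIV" "mat n m z = Z" using ex[OF Z(1)] by blast
  have "{x \<in> {x \<in> ?I \<rightarrow>\<^sub>E UNIV. full_rank (?D x) \<and> e \<notin> N (?D x)}. core (?D x) e - C = 0}
      \<in> product_null_sets ?I"
    using z Z
    by (intro rational_zeros_null[of _ _ _ z] rational_on_diff rational_core[OF df] rational_on_const) auto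
  then show "{Y \<in> carrier_mat n m. full_rank (\<Phi> Y) \<and> e \<notin> N (\<Phi> Y) \<and> core (\<Phi> Y) e = C}
      \<in> null_sets (lebesgue_mat n m)"
    by (intro lebesgue_mat_nullI) (auto simp: conj_assoc)
qed

end

section \<open>The two tests and the witness designs\<close>

context linear_restriction
begin

definition fgls_core :: "real mat \<Rightarrow> real vec \<Rightarrow> real" where
  "fgls_core X e = (R *\<^sub>v beta_tilde a\<^sub>1 a\<^sub>2 X e) \<bullet>
     (minv (Omega_tilde a\<^sub>1 a\<^sub>2 R X e) *\<^sub>v (R *\<^sub>v beta_tilde a\<^sub>1 a\<^sub>2 X e))"

definition ols_core :: "real mat \<Rightarrow> real vec \<Rightarrow> real" where
  "ols_core X e = (R *\<^sub>v beta_hat X e) \<bullet> (minv (Omega_hat a\<^sub>1 a\<^sub>2 R X e) *\<^sub>v (R *\<^sub>v beta_hat X e))"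

lemma regular_test_FGLS:
  "regular_test n k q a\<^sub>1 a\<^sub>2 R r (N2_star a\<^sub>1 a\<^sub>2 R) (T_FGLS a\<^sub>1 a\<^sub>2 R r) fgls_core"
proof unfold_locales
  fix I :: "(nat \<times> nat) set" and D e x\<^sub>0
  assume df: "design_family n k q a\<^sub>1 a\<^sub>2 R r I D e x\<^sub>0"
  interpret design_family n k q a\<^sub>1 a\<^sub>2 R r I D e x\<^sub>0 by fact
  have "U_rank - U_fgls = {x \<in> I \<rightarrow>\<^sub>E UNIV. full_rank (D x) \<and> e \<in> N2_star a\<^sub>1 a\<^sub>2 R (D x)}"
    "U_fgls = {x \<in> I \<rightarrow>\<^sub>E UNIV. full_rank (D x) \<and> e \<notin> N2_star a\<^sub>1 a\<^sub>2 R (D x)}"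
    by (auto simp: U_fgls_def U_rank_def)
  then show "{x \<in> I \<rightarrow>\<^sub>E UNIV. full_rank (D x) \<and> e \<in> N2_star a\<^sub>1 a\<^sub>2 R (D x)} \<in> product_null_sets I"
    "rational_on I {x \<in> I \<rightarrow>\<^sub>E UNIV. full_rank (D x) \<and> e \<notin> N2_star a\<^sub>1 a\<^sub>2 R (D x)}
       (\<lambda>x. fgls_core (D x) e)"
    using fgls_exceptional_null rational_T_FGLS by (simp_all add: fgls_core_def)
qed (simp_all add: T_FGLS_shift fgls_core_def span_exceptional)

lemma regular_test_OLS:
  "regular_test n k q a\<^sub>1 a\<^sub>2 R r (N0_star a\<^sub>1 a\<^sub>2 R) (T_OLS a\<^sub>1 a\<^sub>2 R r) ols_core"
proof unfold_locales
  fix I :: "(nat \<times> nat) set" and D e x\<^sub>0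
  assume df: "design_family n k q a\<^sub>1 a\<^sub>2 R r I D e x\<^sub>0"
  interpret design_family n k q a\<^sub>1 a\<^sub>2 R r I D e x\<^sub>0 by fact
  have "U_rank - U_ols = {x \<in> I \<rightarrow>\<^sub>E UNIV. full_rank (D x) \<and> e \<in> N0_star a\<^sub>1 a\<^sub>2 R (D x)}"
    "U_ols = {x \<in> I \<rightarrow>\<^sub>E UNIV. full_rank (D x) \<and> e \<notin> N0_star a\<^sub>1 a\<^sub>2 R (D x)}"
    by (auto simp: U_ols_def U_rank_def)
  then show "{x \<in> I \<rightarrow>\<^sub>E UNIV. full_rank (D x) \<and> e \<in> N0_star a\<^sub>1 a\<^sub>2 R (D x)} \<in> product_null_sets I"
    "rational_on I {x \<in> I \<rightarrow>\<^sub>E UNIV. full_rank (D x) \<and> e \<notin> N0_star a\<^sub>1 a\<^sub>2 R (D x)}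
       (\<lambda>x. ols_core (D x) e)"
    using ols_exceptional_null rational_T_OLS by (simp_all add: ols_core_def)
qed (simp_all add: T_OLS_shift ols_core_def span_exceptional)

lemma u_hat_eqI:
  assumes X: "full_rank X" and u: "u \<in> carrier_vec n" "transpose_mat X *\<^sub>v u = 0\<^sub>v k"
    and b: "b \<in> carrier_vec k" and e: "e = u + X *\<^sub>v b"
  shows "u_hat X e = u"
  unfolding e u_hat_shift[OF X u(1) b] by (rule u_hat_orthogonal[OF X u])

lemma full_rankI:
  assumes "X \<in> carrier_mat n k" "\<And>v. v \<in> carrier_vec k \<Longrightarrow> X *\<^sub>v v = 0\<^sub>v n \<Longrightarrow> v = 0\<^sub>v k"
  shows "full_rank X"
  using assms det_gram_nonzero_iff[OF assms(1)] by (simp add: full_rank_def)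

lemma mult_vec_index:
  fixes X :: "real mat"
  assumes "X \<in> carrier_mat n k" "v \<in> carrier_vec k" "i < n"
  shows "(X *\<^sub>v v) $ i = (\<Sum>j<k. X $$ (i, j) * v $ j)"
  using assms by (simp add: scalar_prod_def atLeast0LessThan)

lemma rho_bound_from_residual:
  assumes X: "X \<in> carrier_mat n k" and num: "\<And>i. Suc i < n \<Longrightarrow> u_hat X e $ Suc i * u_hat X e $ i = 0"
    and t: "t \<in> {a\<^sub>1..a\<^sub>2}" "u_hat X e $ (t - 1) \<noteq> 0"
  shows "\<bar>rho_num X e\<bar> < rho_den a\<^sub>1 a\<^sub>2 X e"
proof -
  have "rho_num X e = 0"
    unfolding rho_num_def
  proof (intro sum.neutral ballI)
    fix s assume "s \<in> {2..dim_row X}"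
    then have "Suc (s - 2) < n" "s - 1 = Suc (s - 2)" using X by auto
    then show "u_hat X e $ (s - 1) * u_hat X e $ (s - 2) = 0" using num[of "s - 2"] by simp
  qed
  moreover have "rho_den a\<^sub>1 a\<^sub>2 X e > 0"
    unfolding rho_den_def using t by (intro sum_pos2[of _ t]) auto
  ultimately show ?thesis by simp
qed

text \<open>
  The residual of \<open>e\<close> is chosen to be supported on the one index \<open>s = a\<^sub>1 - 1\<close> (counting from 0), the
  first that the denominator of \<open>rho_hat\<close> uses. The first column of the design is \<open>e\<close> without this
  coordinate; the others are the unit vectors at positions \<open>2, \<dots>, k\<close>. As \<open>s \<le> 1\<close>, these avoid
  \<open>s\<close>, and the row \<open>1 - s\<close> is left to the first column alone, which gives full rank.
\<close>

lemma rho_bounded_design: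
  assumes e: "e \<in> carrier_vec n" "\<And>i. i < n \<Longrightarrow> e $ i \<noteq> 0"
  obtains X\<^sub>0 where "X\<^sub>0 \<in> carrier_mat n k" "full_rank X\<^sub>0"
    "\<bar>rho_num X\<^sub>0 e\<bar> < rho_den a\<^sub>1 a\<^sub>2 X\<^sub>0 e"
proof -
  define s where "s = a\<^sub>1 - 1"
  have s: "s \<le> 1" "s < n" using a1 k_pos k_less by (auto simp: s_def)
  define X where "X = mat n k (\<lambda>(i, j). if j = 0 then (if i = s then 0 else e $ i)
      else if i = j + 1 then 1 else 0)"
  define u where "u = vec n (\<lambda>i. if i = s then e $ i else 0)"
  have X: "X \<in> carrier_mat n k" and u: "u \<in> carrier_vec n" by (simp_all add: X_def u_def)
  have full: "full_rank X"
  proof (rule full_rankI[OF X])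
    fix v assume v: "v \<in> carrier_vec k" "X *\<^sub>v v = 0\<^sub>v n"
    have row: "(\<Sum>j<k. X $$ (i, j) * v $ j) = 0" if "i < n" for i
      using mult_vec_index[OF X v(1) that] v(2) that by simp
    have s': "1 - s < n" using k_pos k_less by simp
    have "(\<Sum>j<k. X $$ (1 - s, j) * v $ j) = (\<Sum>j<k. if j = 0 then e $ (1 - s) * v $ j else 0)"
      using s s' by (intro sum.cong) (auto simp: X_def)
    then have v0: "v $ 0 = 0" using row[OF s'] e(2)[OF s'] k_pos by simp
    have "v $ l = 0" if l: "l < k" "l \<noteq> 0" for l
    proof -
      have "l + 1 < n" using l k_less by simp
      moreover have "(\<Sum>j<k. X $$ (l + 1, j) * v $ j) = (\<Sum>j<k. if j = l then v $ j else 0)"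
        using l calculation v0 by (intro sum.cong) (auto simp: X_def)
      ultimately show ?thesis using row[of "l + 1"] l by simp
    qed
    then have "v $ l = 0\<^sub>v k $ l" if "l < k" for l using v0 that by (cases "l = 0") auto
    then show "v = 0\<^sub>v k" using v(1) by (intro eq_vecI) auto
  qed
  have orth: "transpose_mat X *\<^sub>v u = 0\<^sub>v k"
  proof (rule eq_vecI)
    fix j assume "j < dim_vec (0\<^sub>v k :: real vec)"
    then have j: "j < k" by simp
    have "(transpose_mat X *\<^sub>v u) $ j = (\<Sum>i\<in>{0..<n}. X $$ (i, j) * u $ i)"
      using X u j by (simp add: scalar_prod_def)
    also have "\<dots> = 0" using s j by (intro sum.neutral) (auto simp: X_def u_def)
    finally show "(transpose_mat X *\<^sub>v u) $ j = 0\<^sub>v k $ j" using j by simp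
  qed (use X in simp)
  have "X *\<^sub>v unit_vec k 0 = col X 0" using mult_unit_vec[OF X] k_pos by simp
  then have "e = u + X *\<^sub>v unit_vec k 0"
    using e X k_pos by (intro eq_vecI) (auto simp: u_def X_def)
  then have res: "u_hat X e = u" using u_hat_eqI[OF full u orth] by simp
  have "\<bar>rho_num X e\<bar> < rho_den a\<^sub>1 a\<^sub>2 X e"
  proof (rule rho_bound_from_residual[OF X, of _ a\<^sub>1])
    show "u_hat X e $ (a\<^sub>1 - 1) \<noteq> 0" unfolding res s_def[symmetric] using s e(2)[of s] by (simp add: u_def)
  qed (use a1_le in \<open>auto simp: res u_def\<close>)
  with X full that show thesis by blast
qed

text \<open>
  The residual of \<open>e_minus\<close> is \<open>-1\<close> at position 0 and \<open>1\<close> at position 3, its own values there: the two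
  values sum to zero, so the residual is orthogonal to the intercept, and the positions are not
  neighbours. The denominator of \<open>rho_hat\<close> uses at least one of them: position 0 if \<open>a\<^sub>1 = 1\<close>, and
  position 3 if \<open>a\<^sub>1 = 2\<close>, because then \<open>2 \<le> k \<le> a\<^sub>2 - a\<^sub>1\<close> forces \<open>a\<^sub>2 \<ge> 4\<close>.
  The second column of the design is \<open>e_minus\<close> off these two positions, and the remaining columns are the unit vectors at \<open>2, 4, 5, \<dots>\<close>, leaving row 0 to the
  intercept and row 1 to the first two columns.
\<close>

lemma rho_bounded_intercept_design:
  assumes k2: "2 \<le> k" and n4: "4 \<le> n" and ka: "k \<le> a\<^sub>2 - a\<^sub>1"
  obtains Xt\<^sub>0 where "Xt\<^sub>0 \<in> carrier_mat n (k - 1)" "full_rank (with_intercept n Xt\<^sub>0)"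
    "\<bar>rho_num (with_intercept n Xt\<^sub>0) (e_minus n)\<bar>
       < rho_den a\<^sub>1 a\<^sub>2 (with_intercept n Xt\<^sub>0) (e_minus n)"
proof -
  let ?e = "e_minus n"
  define g where "g j = (if j = 2 then 2 else j + 1)" for j :: nat
  define Xt where "Xt = mat n (k - 1) (\<lambda>(i, j). if j = 0 then (if i = 0 \<or> i = 3 then 0 else ?e $ i)
      else if i = g (j + 1) then 1 else 0)"
  define X where "X = with_intercept n Xt"
  define u :: "real vec" where "u = vec n (\<lambda>i. if i = 0 then -1 else if i = 3 then 1 else 0)"
  have Xt: "Xt \<in> carrier_mat n (k - 1)" by (simp add: Xt_def)
  have X: "X \<in> carrier_mat n k" using with_intercept_carrier[OF Xt] k_pos by (simp add: X_def)
  have u: "u \<in> carrier_vec n" by (simp add: u_def)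
  have Xij: "X $$ (i, j) = (if j = 0 then 1 else if j = 1 then (if i = 0 \<or> i = 3 then 0 else ?e $ i)
      else if i = g j then 1 else 0)" if "i < n" "j < k" for i j
    using that with_intercept_index[OF Xt that] by (auto simp: X_def Xt_def)
  have e: "?e $ i \<noteq> 0" if "i < n" for i using that by (simp add: e_minus_def)
  have full: "full_rank X"
  proof (rule full_rankI[OF X])
    fix v assume v: "v \<in> carrier_vec k" "X *\<^sub>v v = 0\<^sub>v n"
    have row: "(\<Sum>j<k. X $$ (i, j) * v $ j) = 0" if "i < n" for i
      using mult_vec_index[OF X v(1) that] v(2) that by simp
    have "(\<Sum>j<k. X $$ (0, j) * v $ j) = (\<Sum>j<k. if j = 0 then v $ j else 0)"
      using n4 by (intro sum.cong) (auto simp: Xij g_def)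
    then have v0: "v $ 0 = 0" using row[of 0] n4 k_pos by simp
    have "(\<Sum>j<k. X $$ (1, j) * v $ j) = (\<Sum>j<k. if j = 1 then ?e $ 1 * v $ j else 0)"
      using n4 v0 by (intro sum.cong) (auto simp: Xij g_def)
    then have v1: "v $ 1 = 0" using row[of 1] e[of 1] n4 k2 by simp
    have "v $ l = 0" if l: "l < k" "l \<noteq> 0" "l \<noteq> 1" for l
    proof -
      have "g l < n" using l k_less n4 by (simp add: g_def)
      moreover have "(\<Sum>j<k. X $$ (g l, j) * v $ j) = (\<Sum>j<k. if j = l then v $ j else 0)"
        using l calculation v0 v1 by (intro sum.cong) (auto simp: Xij g_def split: if_splits)
      ultimately show ?thesis using row[of "g l"] l by simp
    qed
    then have "v $ l = 0\<^sub>v k $ l" if "l < k" for l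
      using v0 v1 that by (cases "l = 0"; cases "l = 1") auto
    then show "v = 0\<^sub>v k" using v(1) by (intro eq_vecI) auto
  qed
  have orth: "transpose_mat X *\<^sub>v u = 0\<^sub>v k"
  proof (rule eq_vecI)
    fix j assume "j < dim_vec (0\<^sub>v k :: real vec)"
    then have j: "j < k" by simp
    have "(transpose_mat X *\<^sub>v u) $ j = (\<Sum>i\<in>{0..<n}. X $$ (i, j) * u $ i)"
      using X u j by (simp add: scalar_prod_def)
    also have "\<dots> = (\<Sum>i\<in>{0, 3}. X $$ (i, j) * u $ i)"
      using n4 by (intro sum.mono_neutral_right) (auto simp: u_def)
    also have "\<dots> = 0" using n4 j by (simp add: Xij u_def g_def)
    finally show "(transpose_mat X *\<^sub>v u) $ j = 0\<^sub>v k $ j" using j by simp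
  qed (use X in simp)
  have "X *\<^sub>v unit_vec k 1 = col X 1" using mult_unit_vec[OF X] k2 by simp
  then have "?e = u + X *\<^sub>v unit_vec k 1"
    using X k2 by (intro eq_vecI) (auto simp: u_def Xij e_minus_def)
  then have res: "u_hat X ?e = u" using u_hat_eqI[OF full u orth] by simp
  \<comment> \<open>The observation, counted from 1, at position 0 or 3, whichever the denominator uses.\<close>
  define t where "t = (if a\<^sub>1 = 1 then 1 else 4 :: nat)"
  have "\<bar>rho_num X ?e\<bar> < rho_den a\<^sub>1 a\<^sub>2 X ?e"
  proof (rule rho_bound_from_residual[OF X, of _ t])
    show "t \<in> {a\<^sub>1..a\<^sub>2}" using a1 a1_le ka k2 by (auto simp: t_def)
    show "u_hat X ?e $ (t - 1) \<noteq> 0" unfolding res using n4 by (simp add: t_def u_def)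
  qed (auto simp: res u_def)
  with Xt full that show thesis unfolding X_def by blast
qed

end

section \<open>Designs that are not covered\<close>

context regular_test
begin

lemma XX0_eq: "XX0 n k = {X \<in> carrier_mat n k. full_rank X}"
  using full_rank_iff_XX0 by (auto simp: XX0_def)

lemma XX1_eq: "XX1 n k N e = {X \<in> carrier_mat n k. full_rank X \<and> e \<in> N X}"
  by (auto simp: XX1_def XX0_eq)

lemma XX2_eq:
  assumes e: "e \<in> carrier_vec n"
  shows "XX2 n k R r C N T e = {X \<in> carrier_mat n k. full_rank X \<and> e \<notin> N X \<and> core X e = C}"
    and "{X \<in> XX0 n k - XX1 n k N e. \<forall>\<mu> \<in> null_means R r X. T X (e + \<mu>) = C} =
      {X \<in> carrier_mat n k. full_rank X \<and> e \<notin> N X \<and> core X e = C}"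
proof -
  show "XX2 n k R r C N T e = {X \<in> carrier_mat n k. full_rank X \<and> e \<notin> N X \<and> core X e = C}"
    using ex_T_iff(1)[OF _ e] by (auto simp only: XX2_def XX1_eq XX0_eq mem_Collect_eq Diff_iff)
  show "{X \<in> XX0 n k - XX1 n k N e. \<forall>\<mu> \<in> null_means R r X. T X (e + \<mu>) = C} =
      {X \<in> carrier_mat n k. full_rank X \<and> e \<notin> N X \<and> core X e = C}"
    using ex_T_iff(2)[OF _ e] by (auto simp only: XX1_eq XX0_eq mem_Collect_eq Diff_iff)
qed

lemma XXt0_eq: "XXt0 n k = {Xt \<in> carrier_mat n (k - 1). full_rank (with_intercept n Xt)}"
  using full_rank_iff_XX0 with_intercept_carrier[OF _ k_pos] by (auto simp: XX0_def XXt0_def)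

lemma XXt1_eq:
  "XXt1 n k N e = {Xt \<in> carrier_mat n (k - 1). full_rank (with_intercept n Xt) \<and> e \<in> N (with_intercept n Xt)}"
  by (auto simp: XXt1_def XXt0_eq)

lemma XXt2_eq:
  assumes e: "e \<in> carrier_vec n"
  shows "XXt2 n k R r C N T e = {Xt \<in> carrier_mat n (k - 1). full_rank (with_intercept n Xt) \<and>
      e \<notin> N (with_intercept n Xt) \<and> core (with_intercept n Xt) e = C}"
    and "{Xt \<in> XXt0 n k - XXt1 n k N e. \<forall>\<mu> \<in> null_means R r (with_intercept n Xt).
        T (with_intercept n Xt) (e + \<mu>) = C} =
      {Xt \<in> carrier_mat n (k - 1). full_rank (with_intercept n Xt) \<and>
        e \<notin> N (with_intercept n Xt) \<and> core (with_intercept n Xt) e = C}"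
proof -
  show "XXt2 n k R r C N T e = {Xt \<in> carrier_mat n (k - 1). full_rank (with_intercept n Xt) \<and>
      e \<notin> N (with_intercept n Xt) \<and> core (with_intercept n Xt) e = C}"
    using ex_T_iff(1)[OF _ e] by (auto simp only: XXt2_def XXt1_eq XXt0_eq mem_Collect_eq Diff_iff)
  show "{Xt \<in> XXt0 n k - XXt1 n k N e. \<forall>\<mu> \<in> null_means R r (with_intercept n Xt).
        T (with_intercept n Xt) (e + \<mu>) = C} =
      {Xt \<in> carrier_mat n (k - 1). full_rank (with_intercept n Xt) \<and>
        e \<notin> N (with_intercept n Xt) \<and> core (with_intercept n Xt) e = C}"
    using ex_T_iff(2)[OF _ e] by (auto simp only: XXt1_eq XXt0_eq mem_Collect_eq Diff_iff)
qed

lemma rational_identity_design: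
  "rational_mat ({..<n} \<times> {..<k}) (({..<n} \<times> {..<k}) \<rightarrow>\<^sub>E UNIV) n k (\<lambda>f. mat n k f)"
proof (rule rational_matI)
  fix i j assume "i < n" "j < k"
  then show "rational_on ({..<n} \<times> {..<k}) (({..<n} \<times> {..<k}) \<rightarrow>\<^sub>E UNIV) (\<lambda>f. mat n k f $$ (i, j))"
    by (auto intro!: rational_on_poly poly_fun.coord)
qed simp

lemma rational_intercept_design:
  "rational_mat ({..<n} \<times> {..<k - 1}) (({..<n} \<times> {..<k - 1}) \<rightarrow>\<^sub>E UNIV) n k
     (\<lambda>f. with_intercept n (mat n (k - 1) f))"
proof (rule rational_matI)
  let ?I = "{..<n} \<times> {..<k - 1}"
  fix i j assume ij: "i < n" "j < k"
  have "rational_on ?I (?I \<rightarrow>\<^sub>E UNIV) (\<lambda>f. if j = 0 then 1 else f (i, j - 1))"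
    using ij by (cases "j = 0") (auto intro!: rational_on_poly poly_fun.coord poly_fun.const)
  then show "rational_on ?I (?I \<rightarrow>\<^sub>E UNIV) (\<lambda>f. with_intercept n (mat n (k - 1) f) $$ (i, j))"
    by (rule rational_on_cong) (use ij in \<open>auto simp: with_intercept_index[of _ n k]\<close>)
qed (intro with_intercept_carrier k_pos mat_carrier)

lemma e_nonzero:
  assumes "e \<in> {e_plus n, e_minus n}"
  shows "e \<in> carrier_vec n" "\<And>i. i < n \<Longrightarrow> e $ i \<noteq> 0"
  using assms by (auto simp: e_plus_def e_minus_def)

text \<open>
  If \<open>XX2\<close> is a proper subset, a design outside it is a point at which the rational function
  \<open>core - C\<close> is nonzero, as \<open>exceptional_design_sets\<close> requires.
\<close>

lemma general_designs:
  "(\<forall>e \<in> {e_plus n, e_minus n}.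
      XX1 n k N e \<in> null_sets (lebesgue_mat n k) \<and>
      XX2 n k R r C N T e =
        {X \<in> XX0 n k - XX1 n k N e. \<forall>\<mu> \<in> null_means R r X. T X (e + \<mu>) = C} \<and>
      (XX2 n k R r C N T e \<subset> XX0 n k - XX1 n k N e \<longrightarrow>
         XX2 n k R r C N T e \<in> null_sets (lebesgue_mat n k))) \<and>
   {X \<in> XX0 n k. \<not> covered R r C N T X} \<subseteq>
     (XX1 n k N (e_plus n) \<union> XX2 n k R r C N T (e_plus n)) \<inter>
     (XX1 n k N (e_minus n) \<union> XX2 n k R r C N T (e_minus n)) \<and>
   ((\<exists>e \<in> {e_plus n, e_minus n}. XX2 n k R r C N T e \<subset> XX0 n k - XX1 n k N e) \<longrightarrow>
      {X \<in> XX0 n k. \<not> covered R r C N T X} \<in> null_sets (lebesgue_mat n k)) \<and>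
   carrier_mat n k - XX0 n k \<in> null_sets (lebesgue_mat n k)"
proof -
  let ?L = "null_sets (lebesgue_mat n k)" and ?E = "{e_plus n, e_minus n}"
  let ?nc = "{X \<in> XX0 n k. \<not> covered R r C N T X}"
  have N1: "XX1 n k N e \<in> ?L"
    and N2: "XX2 n k R r C N T e \<subset> XX0 n k - XX1 n k N e \<Longrightarrow> XX2 n k R r C N T e \<in> ?L"
    and N0: "carrier_mat n k - XX0 n k \<in> ?L" if "e \<in> ?E" for e
  proof -
    note e = e_nonzero[OF that]
    obtain X\<^sub>0 where X0: "X\<^sub>0 \<in> carrier_mat n k" "full_rank X\<^sub>0"
      "\<bar>rho_num X\<^sub>0 e\<bar> < rho_den a\<^sub>1 a\<^sub>2 X\<^sub>0 e"
      using rho_bounded_design[OF e] .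
    note ex = exceptional_design_sets[where \<Phi> = "\<lambda>Y. Y", OF rational_identity_design e(1) X0]
    have "carrier_mat n k - XX0 n k = {Y \<in> carrier_mat n k. \<not> full_rank Y}" by (auto simp: XX0_eq)
    then show "carrier_mat n k - XX0 n k \<in> ?L" using ex(1) by simp
    show "XX1 n k N e \<in> ?L" unfolding XX1_eq by (rule ex(2))
    assume "XX2 n k R r C N T e \<subset> XX0 n k - XX1 n k N e"
    then obtain Z where "Z \<in> XX0 n k - XX1 n k N e" "Z \<notin> XX2 n k R r C N T e" by blast
    then have "Z \<in> carrier_mat n k" "full_rank Z" "e \<notin> N Z" "core Z e \<noteq> C"
      by (auto simp: XX0_eq XX1_eq XX2_eq[OF e(1)])
    then show "XX2 n k R r C N T e \<in> ?L" unfolding XX2_eq[OF e(1)] by (rule ex(3))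
  qed
  have sub: "?nc \<subseteq> XX1 n k N e \<union> XX2 n k R r C N T e" if "e \<in> ?E" for e
    using not_covered_imp_eq[OF _ that] unfolding XX0_eq XX1_eq XX2_eq[OF e_nonzero(1)[OF that]]
    by blast
  have nc: "?nc \<in> ?L" if "e \<in> ?E" "XX2 n k R r C N T e \<subset> XX0 n k - XX1 n k N e" for e
    by (rule lebesgue_mat_null_subset[OF sub[OF that(1)] null_sets.Un[OF N1[OF that(1)] N2[OF that]]])
  have eq: "XX2 n k R r C N T e =
      {X \<in> XX0 n k - XX1 n k N e. \<forall>\<mu> \<in> null_means R r X. T X (e + \<mu>) = C}" if "e \<in> ?E" for e
    using XX2_eq[OF e_nonzero(1)[OF that]] by (rule trans[OF _ sym])
  show ?thesis (is "(\<forall>e \<in> _. ?A e) \<and> _ \<and> (?proper \<longrightarrow> _) \<and> _")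
  proof (intro conjI)
    show "\<forall>e \<in> ?E. ?A e" by (intro ballI conjI impI N1 eq N2)
    show "?nc \<subseteq> (XX1 n k N (e_plus n) \<union> XX2 n k R r C N T (e_plus n)) \<inter>
        (XX1 n k N (e_minus n) \<union> XX2 n k R r C N T (e_minus n))"
      by (intro Int_greatest sub) simp_all
    show "?proper \<longrightarrow> ?nc \<in> ?L" using nc by blast
    show "carrier_mat n k - XX0 n k \<in> ?L" by (rule N0[of "e_plus n"]) simp
  qed
qed

lemma intercept_designs:
  assumes k2: "2 \<le> k" and n4: "4 \<le> n" and ka: "k \<le> a\<^sub>2 - a\<^sub>1"
  shows "(\<forall>e \<in> {e_plus n, e_minus n}.
      XXt2 n k R r C N T e =
        {Xt \<in> XXt0 n k - XXt1 n k N e.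
           \<forall>\<mu> \<in> null_means R r (with_intercept n Xt). T (with_intercept n Xt) (e + \<mu>) = C}) \<and>
    XXt1 n k N (e_minus n) \<in> null_sets (lebesgue_mat n (k - 1)) \<and>
    (XXt2 n k R r C N T (e_minus n) \<subset> XXt0 n k - XXt1 n k N (e_minus n) \<longrightarrow>
       XXt2 n k R r C N T (e_minus n) \<in> null_sets (lebesgue_mat n (k - 1))) \<and>
    XXt1 n k N (e_plus n) = XXt0 n k \<and>
    XXt2 n k R r C N T (e_plus n) = {} \<and>
    {Xt \<in> XXt0 n k. \<not> covered R r C N T (with_intercept n Xt)} \<subseteq>
      XXt1 n k N (e_minus n) \<union> XXt2 n k R r C N T (e_minus n) \<and>
    (XXt2 n k R r C N T (e_minus n) \<subset> XXt0 n k - XXt1 n k N (e_minus n) \<longrightarrow>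
       {Xt \<in> XXt0 n k. \<not> covered R r C N T (with_intercept n Xt)}
         \<in> null_sets (lebesgue_mat n (k - 1))) \<and>
    carrier_mat n (k - 1) - XXt0 n k \<in> null_sets (lebesgue_mat n (k - 1))"
proof -
  let ?L = "null_sets (lebesgue_mat n (k - 1))" and ?e = "e_minus n"
  let ?nc = "{Xt \<in> XXt0 n k. \<not> covered R r C N T (with_intercept n Xt)}"
  obtain Xt\<^sub>0 where X0: "Xt\<^sub>0 \<in> carrier_mat n (k - 1)" "full_rank (with_intercept n Xt\<^sub>0)"
    "\<bar>rho_num (with_intercept n Xt\<^sub>0) ?e\<bar> < rho_den a\<^sub>1 a\<^sub>2 (with_intercept n Xt\<^sub>0) ?e"
    using rho_bounded_intercept_design[OF assms] .
  note ex = exceptional_design_sets[where \<Phi> = "with_intercept n",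
      OF rational_intercept_design e_carrier(2) X0]
  have "carrier_mat n (k - 1) - XXt0 n k =
      {Y \<in> carrier_mat n (k - 1). \<not> full_rank (with_intercept n Y)}" by (auto simp: XXt0_eq)
  then have N0: "carrier_mat n (k - 1) - XXt0 n k \<in> ?L" using ex(1) by simp
  have N1: "XXt1 n k N ?e \<in> ?L" unfolding XXt1_eq by (rule ex(2))
  have N2: "XXt2 n k R r C N T ?e \<in> ?L"
    if "XXt2 n k R r C N T ?e \<subset> XXt0 n k - XXt1 n k N ?e"
  proof -
    obtain Z where "Z \<in> XXt0 n k - XXt1 n k N ?e" "Z \<notin> XXt2 n k R r C N T ?e"
      using \<open>_ \<subset> _\<close> by blast
    then have "Z \<in> carrier_mat n (k - 1)" "full_rank (with_intercept n Z)"
      "?e \<notin> N (with_intercept n Z)" "core (with_intercept n Z) ?e \<noteq> C"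
      by (auto simp: XXt0_eq XXt1_eq XXt2_eq[OF e_carrier(2)])
    then show ?thesis unfolding XXt2_eq[OF e_carrier(2)] by (rule ex(3))
  qed
  have sub: "?nc \<subseteq> XXt1 n k N ?e \<union> XXt2 n k R r C N T ?e"
    using not_covered_imp_eq unfolding XXt0_eq XXt1_eq XXt2_eq[OF e_carrier(2)] by blast
  have nc: "?nc \<in> ?L" if "XXt2 n k R r C N T ?e \<subset> XXt0 n k - XXt1 n k N ?e"
    by (rule lebesgue_mat_null_subset[OF sub null_sets.Un[OF N1 N2[OF that]]])
  have "e_plus n \<in> N (with_intercept n Xt)"
    if "Xt \<in> carrier_mat n (k - 1)" "full_rank (with_intercept n Xt)" for Xt
    using span_in_N[OF that(2), of "unit_vec k 0"] with_intercept_unit_vec[OF that(1) k_pos] by simp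
  then have plus: "XXt1 n k N (e_plus n) = XXt0 n k" "XXt2 n k R r C N T (e_plus n) = {}"
    by (auto simp: XXt0_eq XXt1_eq XXt2_eq[OF e_carrier(1)])
  have "\<forall>e \<in> {e_plus n, e_minus n}. XXt2 n k R r C N T e =
        {Xt \<in> XXt0 n k - XXt1 n k N e.
           \<forall>\<mu> \<in> null_means R r (with_intercept n Xt). T (with_intercept n Xt) (e + \<mu>) = C}"
  proof
    fix e assume "e \<in> {e_plus n, e_minus n}"
    note e = e_nonzero(1)[OF this]
    show "XXt2 n k R r C N T e =
        {Xt \<in> XXt0 n k - XXt1 n k N e.
           \<forall>\<mu> \<in> null_means R r (with_intercept n Xt). T (with_intercept n Xt) (e + \<mu>) = C}"
      using XXt2_eq[OF e] by (rule trans[OF _ sym])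
  qed
  then show ?thesis using N0 N1 sub plus by (intro conjI impI N2 nc)
qed

lemma intercept_covered:
  assumes col: "col R 0 \<noteq> 0\<^sub>v q" and Xt: "Xt \<in> XXt0 n k"
  shows "cover_iii R (with_intercept n Xt) (e_plus n)" "covered R r C N T (with_intercept n Xt)"
proof -
  let ?X = "with_intercept n Xt"
  have X: "full_rank ?X" and Xtc: "Xt \<in> carrier_mat n (k - 1)" using Xt by (auto simp: XXt0_eq)
  note X1 = with_intercept_unit_vec[OF Xtc k_pos]
  have "beta_hat ?X (e_plus n) = unit_vec k 0"
    using beta_hat_span[OF X, of "unit_vec k 0"] X1 by simp
  then have "R *\<^sub>v beta_hat ?X (e_plus n) = col R 0"
    using mult_unit_vec[OF R] k_pos by simp
  moreover have "e_plus n \<in> vec_space.col_space n ?X"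
    using vec_space.col_space_eq[OF full_rankD(1)[OF X]] X1 e_carrier(1) full_rankD(6,7)[OF X] by auto
  ultimately show iii: "cover_iii R ?X (e_plus n)"
    using col R full_rankD(6)[OF X] by (simp add: cover_iii_def)
  then show "covered R r C N T ?X" unfolding covered_def full_rankD(6)[OF X] by blast
qed

end

theorem proposition3p16:
  fixes n k q a\<^sub>1 a\<^sub>2 :: nat
    and R :: "real mat" and r :: "real vec" and C :: real and CC :: "real mat set"
  assumes "1 \<le> k" and "k < n" and "1 \<le> q"
    and "covariance_model n CC" and "C_AR1 n \<subseteq> CC"
    and "R \<in> carrier_mat q k" and "mat_rank R = q" and "r \<in> carrier_vec q"
    and "0 < C"
    and "a\<^sub>1 \<in> {1, 2}" and "a\<^sub>2 \<in> {n - 1, n}" and "a\<^sub>1 \<le> a\<^sub>2" and "k \<le> a\<^sub>2 - a\<^sub>1"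
  shows
    "(\<forall>(N, T) \<in> {(N2_star a\<^sub>1 a\<^sub>2 R, T_FGLS a\<^sub>1 a\<^sub>2 R r), (N0_star a\<^sub>1 a\<^sub>2 R, T_OLS a\<^sub>1 a\<^sub>2 R r)}.
       ((\<forall>e \<in> {e_plus n, e_minus n}.
            XX1 n k N e \<in> null_sets (lebesgue_mat n k) \<and>
            XX2 n k R r C N T e =
              {X \<in> XX0 n k - XX1 n k N e. \<forall>\<mu> \<in> null_means R r X. T X (e + \<mu>) = C} \<and>
            (XX2 n k R r C N T e \<subset> XX0 n k - XX1 n k N e \<longrightarrow>
               XX2 n k R r C N T e \<in> null_sets (lebesgue_mat n k))) \<and>
        {X \<in> XX0 n k. \<not> covered R r C N T X} \<subseteq>
          (XX1 n k N (e_plus n) \<union> XX2 n k R r C N T (e_plus n)) \<inter>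
          (XX1 n k N (e_minus n) \<union> XX2 n k R r C N T (e_minus n)) \<and>
        ((\<exists>e \<in> {e_plus n, e_minus n}. XX2 n k R r C N T e \<subset> XX0 n k - XX1 n k N e) \<longrightarrow>
           {X \<in> XX0 n k. \<not> covered R r C N T X} \<in> null_sets (lebesgue_mat n k)) \<and>
        carrier_mat n k - XX0 n k \<in> null_sets (lebesgue_mat n k)) \<and>
       (2 \<le> k \<and> 4 \<le> n \<longrightarrow>
          (\<forall>e \<in> {e_plus n, e_minus n}.
             XXt2 n k R r C N T e =
               {Xt \<in> XXt0 n k - XXt1 n k N e.
                  \<forall>\<mu> \<in> null_means R r (with_intercept n Xt).
                    T (with_intercept n Xt) (e + \<mu>) = C}) \<and>
          XXt1 n k N (e_minus n) \<in> null_sets (lebesgue_mat n (k - 1)) \<and>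
          (XXt2 n k R r C N T (e_minus n) \<subset> XXt0 n k - XXt1 n k N (e_minus n) \<longrightarrow>
             XXt2 n k R r C N T (e_minus n) \<in> null_sets (lebesgue_mat n (k - 1))) \<and>
          XXt1 n k N (e_plus n) = XXt0 n k \<and>
          XXt2 n k R r C N T (e_plus n) = {} \<and>
          {Xt \<in> XXt0 n k. \<not> covered R r C N T (with_intercept n Xt)} \<subseteq>
            XXt1 n k N (e_minus n) \<union> XXt2 n k R r C N T (e_minus n) \<and>
          (XXt2 n k R r C N T (e_minus n) \<subset> XXt0 n k - XXt1 n k N (e_minus n) \<longrightarrow>
             {Xt \<in> XXt0 n k. \<not> covered R r C N T (with_intercept n Xt)}
               \<in> null_sets (lebesgue_mat n (k - 1))) \<and>
          carrier_mat n (k - 1) - XXt0 n k \<in> null_sets (lebesgue_mat n (k - 1)))) \<and>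
     (col R 0 \<noteq> 0\<^sub>v q \<longrightarrow>
       (\<forall>Xt \<in> XXt0 n k.
          cover_iii R (with_intercept n Xt) (e_plus n) \<and>
          covered R r C (N2_star a\<^sub>1 a\<^sub>2 R) (T_FGLS a\<^sub>1 a\<^sub>2 R r) (with_intercept n Xt) \<and>
          covered R r C (N0_star a\<^sub>1 a\<^sub>2 R) (T_OLS a\<^sub>1 a\<^sub>2 R r) (with_intercept n Xt)))"
proof -
  interpret linear_restriction n k q a\<^sub>1 a\<^sub>2 R r
    using assms by unfold_locales auto
  interpret fgls: regular_test n k q a\<^sub>1 a\<^sub>2 R r "N2_star a\<^sub>1 a\<^sub>2 R" "T_FGLS a\<^sub>1 a\<^sub>2 R r" fgls_core
    by (rule regular_test_FGLS)
  interpret ols: regular_test n k q a\<^sub>1 a\<^sub>2 R r "N0_star a\<^sub>1 a\<^sub>2 R" "T_OLS a\<^sub>1 a\<^sub>2 R r" ols_core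
    by (rule regular_test_OLS)
  have ka: "k \<le> a\<^sub>2 - a\<^sub>1" by fact
  show ?thesis (is "(\<forall>(N, T) \<in> _. ?P N T) \<and> ?Q")
  proof
    have fgls: "?P (N2_star a\<^sub>1 a\<^sub>2 R) (T_FGLS a\<^sub>1 a\<^sub>2 R r)"
      by (intro conjI[OF fgls.general_designs] impI, elim conjE) (rule fgls.intercept_designs[OF _ _ ka])
    have ols: "?P (N0_star a\<^sub>1 a\<^sub>2 R) (T_OLS a\<^sub>1 a\<^sub>2 R r)"
      by (intro conjI[OF ols.general_designs] impI, elim conjE) (rule ols.intercept_designs[OF _ _ ka])
    show "\<forall>(N, T) \<in> {(N2_star a\<^sub>1 a\<^sub>2 R, T_FGLS a\<^sub>1 a\<^sub>2 R r),
        (N0_star a\<^sub>1 a\<^sub>2 R, T_OLS a\<^sub>1 a\<^sub>2 R r)}. ?P N T"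
    proof
      fix NT
      assume "NT \<in> {(N2_star a\<^sub>1 a\<^sub>2 R, T_FGLS a\<^sub>1 a\<^sub>2 R r), (N0_star a\<^sub>1 a\<^sub>2 R, T_OLS a\<^sub>1 a\<^sub>2 R r)}"
      then consider "NT = (N2_star a\<^sub>1 a\<^sub>2 R, T_FGLS a\<^sub>1 a\<^sub>2 R r)"
        | "NT = (N0_star a\<^sub>1 a\<^sub>2 R, T_OLS a\<^sub>1 a\<^sub>2 R r)" by blast
      then show "case NT of (N, T) \<Rightarrow> ?P N T"
      proof cases
        case 1
        show ?thesis unfolding 1 prod.case by (rule fgls)
      next
        case 2
        show ?thesis unfolding 2 prod.case by (rule ols)
      qed
    qed
    show ?Q
      using fgls.intercept_covered ols.intercept_covered by (intro impI ballI conjI)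
  qed
qed

end
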